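(* Let $G=(V,\mathcal E,w)$ be an undirected, connected, weighted graph on $n$ nodes with Laplacian $L=\sum_{e\in\mathcal E}w(e)E_eE_e^T$ and largest Laplacian eigenvalue $\lambda_n$. Let $\tau\ge0$ with $\tau\lambda_n<\pi/2$. Consider the consensus network with dynamics noise $$\dot x(t)=-L\,x(t-\tau)+\xi(t),\qquad y=M_nx,$$ where $\xi$ is a vector of $n$ mutually independent zero-mean Gaussian white noises of unit intensity. Then for every link $e=\{i,j\}\in\mathcal E$ the sensitivity coefficient is $$\kappa_e=\frac12\,E_e^{T}\,(L^2)^{\dagger}\big(\tau L-\cos(\tau L)\big)\big(M_n-\sin(\tau L)\big)^{\dagger}\,E_e .$$
   Context: Notation: - $E_e=e_i-e_j\in\mathbb R^n$, for an arbitrary orientation. - $M_n=I_n-\frac1n\mathbf1\mathbf1^T$. - $X^\dagger$ is the Moore–Penrose pseudo-inverse. - $\cos(X)$ and $\sin(X)$ are the matrix power-series functions. The performance is $$\rho_{ss}(L;\tau)=\lim_{t\to\infty}\mathbb E[y^Ty]=\frac1{2\pi}\int_{-\infty}^\infty\mathrm{Tr}[G(j\omega)^HG(j\omega)]d\omega,\qquad G(s)=M_n(sI+e^{-\tau s}L)^{-1}.$$ The sensitivity coefficient of link $e$ is $\kappa_e=\partial\rho_{ss}/\partial w(e)$, the derivative of the performance with respect to the weight of $e$. *)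

theory Defs
  imports "HOL-Analysis.Analysis"
begin

fun mpow :: "real^'n^'n \<Rightarrow> nat \<Rightarrow> real^'n^'n" where
  "mpow X 0 = mat 1"
| "mpow X (Suc k) = X ** mpow X k"

definition mat_cos :: "real^'n^'n \<Rightarrow> real^'n^'n" where
  "mat_cos X = (\<Sum>k. ((-1)^k / fact (2*k)) *\<^sub>R mpow X (2*k))"

definition mat_sin :: "real^'n^'n \<Rightarrow> real^'n^'n" where
  "mat_sin X = (\<Sum>k. ((-1)^k / fact (2*k+1)) *\<^sub>R mpow X (2*k+1))"

definition pinv :: "real^'n^'n \<Rightarrow> real^'n^'n" where
  "pinv X = (THE Y. X ** Y ** X = X \<and> Y ** X ** Y = Y \<and>
                    transpose (X ** Y) = X ** Y \<and> transpose (Y ** X) = Y ** X)"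

definition Mn :: "real^'n^'n" where
  "Mn = (\<chi> i j. (if i = j then 1 else 0) - 1 / real CARD('n))"

definition Evec :: "'n \<Rightarrow> 'n \<Rightarrow> real^'n" where
  "Evec i j = axis i 1 - axis j 1"

definition outer :: "real^'n \<Rightarrow> real^'n \<Rightarrow> real^'n^'n" where
  "outer u v = (\<chi> a b. u $ a * v $ b)"

definition Edge_vec :: "'n set \<Rightarrow> real^'n" where
  "Edge_vec e = (let p = (SOME p. e = {fst p, snd p} \<and> fst p \<noteq> snd p) in Evec (fst p) (snd p))"

definition laplacian :: "'n set set \<Rightarrow> ('n set \<Rightarrow> real) \<Rightarrow> real^'n^'n" where
  "laplacian E w = (\<Sum>e\<in>E. w e *\<^sub>R outer (Edge_vec e) (Edge_vec e))"

definition connected_wgraph :: "'n set set \<Rightarrow> ('n set \<Rightarrow> real) \<Rightarrow> bool" where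
  "connected_wgraph E w \<longleftrightarrow>
     (\<forall>e\<in>E. \<exists>i j. i \<noteq> j \<and> e = {i, j}) \<and> (\<forall>e\<in>E. w e > 0) \<and>
     (\<forall>a b. (\<lambda>x y. {x, y} \<in> E)\<^sup>*\<^sup>* a b)"

definition eigenvalues :: "real^'n^'n \<Rightarrow> real set" where
  "eigenvalues A = {c. \<exists>v. v \<noteq> 0 \<and> A *v v = c *\<^sub>R v}"

definition lambda_max :: "real^'n^'n \<Rightarrow> real" where
  "lambda_max A = Max (eigenvalues A)"

definition cmat :: "real^'n^'n \<Rightarrow> complex^'n^'n" where
  "cmat A = (\<chi> i j. complex_of_real (A $ i $ j))"

definition conj_transpose :: "complex^'n^'n \<Rightarrow> complex^'n^'n" where
  "conj_transpose A = (\<chi> i j. cnj (A $ j $ i))"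

definition transfer :: "real^'n^'n \<Rightarrow> real \<Rightarrow> complex \<Rightarrow> complex^'n^'n" where
  "transfer L \<tau> s = cmat Mn ** matrix_inv (mat s + mat (exp (- complex_of_real \<tau> * s)) ** cmat L)"

text \<open>H2 performance rho_ss(L;tau) = (1/2pi) int Tr[G(jw)^H G(jw)] dw (the trace is real).\<close>
definition rho_ss :: "real^'n^'n \<Rightarrow> real \<Rightarrow> real" where
  "rho_ss L \<tau> = 1 / (2 * pi) *
     Re (integral UNIV (\<lambda>\<omega>::real. trace (conj_transpose (transfer L \<tau> (\<i> * \<omega>)) ** transfer L \<tau> (\<i> * \<omega>))))"

end

theory Submission
  imports Defs "HOL-Complex_Analysis.Cauchy_Integral_Formula" "HOL-Real_Asymp.Real_Asymp"
begin

text \<open>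
  In an orthonormal eigenbasis of \<open>L\<close> the performance is the sum, over the nonzero eigenvalues
  \<open>\<lambda>\<close>, of \<open>f(\<lambda>) = cos(\<tau>\<lambda>) / (2\<lambda>(1 - sin(\<tau>\<lambda>)))\<close>. This value of the frequency integral
  follows from Cauchy's theorem on a half disc, because \<open>s + \<lambda> e\<^sup>-\<^sup>\<tau>\<^sup>s\<close> has no zero in the closed
  right half plane when \<open>\<tau>\<lambda> < \<pi>/2\<close>.

  Changing the weight of an edge is a rank-one update \<open>L + \<delta> a a\<^sup>T\<close>. For eigenpairs
  \<open>(v, \<lambda>)\<close> of \<open>L\<close> and \<open>(u, \<mu>)\<close> of the update, symmetry gives
  \<open>(v \<bullet> u) (\<mu> - \<lambda>) = \<delta> (a \<bullet> v) (a \<bullet> u)\<close>. Summing against \<open>(v \<bullet> u)\<^sup>2\<close> expresses the error of the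
  first order formula \<open>\<delta> \<Sum> f'(\<lambda>) (a \<bullet> v)\<^sup>2\<close> as a double sum of
  \<open>(v \<bullet> u)\<^sup>2 (f(\<mu>) - f(\<lambda>) - f'(\<lambda>) (\<mu> - \<lambda>))\<close>. Each term is \<open>o(\<delta>)\<close>: either \<open>\<mu>\<close> is close to
  \<open>\<lambda>\<close>, or the relation above forces \<open>v \<bullet> u = O(\<delta>)\<close>. No differentiability of eigenvalues or
  eigenvectors is needed. Finally \<open>f'(\<lambda>) = (\<tau>\<lambda> - cos(\<tau>\<lambda>)) / (2\<lambda>\<^sup>2(1 - sin(\<tau>\<lambda>)))\<close>.
\<close>

section \<open>The frequency integral of a scalar delay system\<close>

text \<open>With \<open>s = - \<i> * z\<close> the expression is
  \<open>s + l * exp (- \<tau> * s)\<close>, and the upper half plane in \<open>z\<close> is the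
  right half plane in \<open>s\<close>. At a zero, comparing moduli gives
  \<open>cmod z \<le> l\<close>, so \<open>\<tau> * Re z\<close> lies within the range where the
  cosine is positive; then the exponential term has positive real part, but \<open>\<i> * z\<close>
  does not.\<close>

lemma delay_symbol_nonzero:
  fixes z :: complex
  assumes "0 < l" "0 \<le> \<tau>" "\<tau> * l < pi / 2" "Im z \<ge> 0"
  shows "of_real l * exp (\<i> * of_real \<tau> * z) - \<i> * z \<noteq> 0"
proof
  assume eq: "of_real l * exp (\<i> * of_real \<tau> * z) - \<i> * z = 0"
  define m where "m = exp (- \<tau> * Im z)"
  have m: "0 < m" "m \<le> 1" using assms by (auto simp: m_def)
  have e: "of_real l * exp (\<i> * of_real \<tau> * z) = \<i> * z" using eq by simp
  have "cmod (of_real l * exp (\<i> * of_real \<tau> * z)) = l * m"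
    using assms by (simp add: norm_mult m_def)
  hence "cmod z = l * m" using e by (simp add: norm_mult)
  hence "cmod z \<le> l" using m assms(1) by (simp add: mult_le_cancel_left1)
  hence "\<bar>Re z\<bar> \<le> l" using abs_Re_le_cmod order_trans by blast
  hence "\<tau> * \<bar>Re z\<bar> \<le> \<tau> * l" using assms by (intro mult_left_mono)
  hence "\<bar>\<tau> * Re z\<bar> < pi / 2" using assms by (simp add: abs_mult)
  hence "cos (\<tau> * Re z) > 0" by (intro cos_gt_zero_pi) (auto simp: abs_less_iff)
  hence "l * (m * cos (\<tau> * Re z)) > 0" using m assms by simp
  moreover have "Re (of_real l * exp (\<i> * of_real \<tau> * z)) = l * (m * cos (\<tau> * Re z))"
    by (simp add: Re_exp m_def)
  moreover have "Re (\<i> * z) \<le> 0" using assms by simp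
  ultimately show False using e by simp
qed

lemma sin_less_one:
  fixes a :: real
  assumes "0 \<le> a" "a < pi / 2"
  shows "sin a < 1"
  using sin_monotone_2pi[of a "pi/2"] assms by simp

text \<open>Truncations of a nonnegative function to \<open>{-k..k}\<close> increase to it
  pointwise, so monotone convergence upgrades the principal value to an integral over the whole
  line.\<close>

lemma has_integral_UNIV_of_symmetric_limit:
  fixes f :: "real \<Rightarrow> real"
  assumes cont: "continuous_on UNIV f" and nonneg: "\<And>x. 0 \<le> f x"
    and lim: "((\<lambda>R. integral {-R..R} f) \<longlongrightarrow> J) at_top"
  shows "(f has_integral J) UNIV"
proof -
  define g where "g k x = (if x \<in> {- real k..real k} then f x else 0)" for k :: nat and x
  have gint: "(g k has_integral integral {- real k..real k} f) UNIV" for k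
    unfolding g_def
    by (subst has_integral_restrict_UNIV)
      (intro integrable_integral integrable_continuous_real continuous_on_subset[OF cont] subset_UNIV)
  have gI: "integral UNIV (g k) = integral {- real k..real k} f" for k
    using gint by (rule integral_unique)
  have lim': "(\<lambda>k. integral UNIV (g k)) \<longlonglongrightarrow> J"
    unfolding gI by (rule filterlim_compose[OF lim filterlim_real_sequentially])
  have *: "f integrable_on UNIV \<and> (\<lambda>k. integral UNIV (g k)) \<longlonglongrightarrow> integral UNIV f"
  proof (rule monotone_convergence_increasing)
    show "g k integrable_on UNIV" for k using gint by blast
    show "g k x \<le> g (Suc k) x" for k x using nonneg by (auto simp: g_def)
    show "(\<lambda>k. g k x) \<longlonglongrightarrow> f x" for x
    proof (rule tendsto_eventually)
      obtain N :: nat where "\<bar>x\<bar> \<le> real N" using real_arch_simple by blast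
      hence "\<forall>k\<ge>N. g k x = f x" by (auto simp: g_def)
      thus "\<forall>\<^sub>F k in sequentially. g k x = f x" unfolding eventually_sequentially by blast
    qed
    show "bounded (range (\<lambda>k. integral UNIV (g k)))"
      using convergent_imp_bounded[OF lim'] .
  qed
  hence "integral UNIV f = J" using lim' LIMSEQ_unique by blast
  thus ?thesis using * by (metis integrable_integral)
qed

text \<open>The primitive is \<open>arctan (x / l)\<close>. The integrand is the real part of
  \<open>1 / (l - \<i> * x)\<close>, the compensating term of the contour argument below.\<close>

lemma has_integral_lorentzian:
  fixes l R :: real
  assumes "0 < l" "0 \<le> R"
  shows "((\<lambda>x. l / (l\<^sup>2 + x\<^sup>2)) has_integral 2 * arctan (R / l)) {-R..R}"
proof -
  have pos: "l\<^sup>2 + x\<^sup>2 > 0" for x using assms by (simp add: add_pos_nonneg)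
  have "((\<lambda>x. arctan (x / l)) has_real_derivative l / (l\<^sup>2 + x\<^sup>2)) (at x within {-R..R})" for x
    using assms pos[of x]
    by (auto intro!: derivative_eq_intros simp: field_simps power2_eq_square)
  hence "((\<lambda>x. l / (l\<^sup>2 + x\<^sup>2)) has_integral arctan (R / l) - arctan (-R / l)) {-R..R}"
    using assms by (intro fundamental_theorem_of_calculus)
      (auto simp: has_real_derivative_iff_has_vector_derivative)
  thus ?thesis by (simp add: arctan_minus)
qed

lemma delay_H2_integral_scalar:
  fixes l \<tau> :: real
  assumes l: "0 < l" and t: "0 \<le> \<tau>" and tl: "\<tau> * l < pi / 2"
  shows "((\<lambda>x. 1 / (cmod (of_real l * exp (\<i> * of_real \<tau> * of_real x) - \<i> * of_real x))\<^sup>2)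
           has_integral pi * cos (\<tau> * l) / (l * (1 - sin (\<tau> * l)))) UNIV"
proof -
  \<comment> \<open>On the real axis the real part of \<open>F x\<close> is \<open>(l\<^sup>2 - x\<^sup>2) / \<bar>h x\<bar>\<^sup>2\<close>, and \<open>- \<i> \<beta> z\<close> interpolates
    \<open>F\<close> at \<open>z = \<plusminus>l\<close>. So the real part of \<open>(F z + \<i> \<beta> z) / (l\<^sup>2 - z\<^sup>2)\<close>, which is regular in the upper
    half plane, is the integrand; adding \<open>\<beta> / (l - \<i> z)\<close> makes it \<open>O(z\<^sup>-\<^sup>2)\<close>.\<close>
  define h where "h z = of_real l * exp (\<i> * of_real \<tau> * z) - \<i> * z" for z
  define F where "F z = (of_real l * exp (\<i> * of_real \<tau> * z) + \<i> * z) / h z" for z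
  \<comment> \<open>The solution of \<open>F l = - \<i> * \<beta> * l\<close>. Since
    \<open>F (- l)\<close> is the conjugate of \<open>F l\<close>, the same real number serves at
    \<open>- l\<close>. The integral will come out as \<open>- pi * \<beta>\<close>.\<close>
  define \<beta> where "\<beta> = - cos (\<tau> * l) / (l * (1 - sin (\<tau> * l)))"
  define P where "P z = F z + \<i> * of_real \<beta> * z" for z
  \<comment> \<open>An open set around the closed upper half plane: the points \<open>l\<close> and
    \<open>- l\<close> lie on the boundary line, and removing the singularities there takes a full
    neighbourhood.\<close>
  define U where "U = {z. h z \<noteq> 0}"
  have sn: "sin (\<tau> * l) < 1" using sin_less_one l t tl by simp
  have hU: "{z. Im z \<ge> 0} \<subseteq> U"
    using delay_symbol_nonzero[OF l t tl] by (auto simp: U_def h_def)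
  have hol_h: "h holomorphic_on A" for A unfolding h_def by (intro holomorphic_intros)
  have openU: "open U"
    using open_Collect_neq[of h "\<lambda>_. 0"] hol_h[of UNIV]
    unfolding U_def by (simp add: holomorphic_on_imp_continuous_on)
  have hol_P: "P holomorphic_on U"
    unfolding P_def F_def by (intro holomorphic_intros hol_h) (auto simp: U_def)
  have P0: "P (of_real x) = 0" if "x = l \<or> x = - l" for x
  proof -
    have c: "cos (\<tau> * l) = - \<beta> * (l * (1 - sin (\<tau> * l)))"
      using sn l by (simp add: \<beta>_def)
    have hn: "h (of_real x) \<noteq> 0" using subsetD[OF hU, of "of_real x"] by (simp add: U_def)
    have e: "exp (\<i> * of_real \<tau> * of_real x) = Complex (cos (\<tau> * x)) (sin (\<tau> * x))"
      by (simp add: complex_eq_iff Re_exp Im_exp)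
    \<comment> \<open>This is the numerator of \<open>P\<close> at \<open>x\<close>. Its real part
      vanishes by the choice of \<open>\<beta>\<close>, its imaginary part by that and
      \<open>s2\<close>.\<close>
    have "of_real l * exp (\<i> * of_real \<tau> * of_real x) + \<i> * of_real x
           + \<i> * of_real \<beta> * of_real x * h (of_real x) = 0"
    proof -
      have s2: "(cos (\<tau> * l))\<^sup>2 = (1 - sin (\<tau> * l)) * (1 + sin (\<tau> * l))"
        using sin_cos_squared_add[of "\<tau> * l"] by (simp add: algebra_simps power2_eq_square)
      have "\<beta> * l * cos (\<tau> * l) = - ((cos (\<tau> * l))\<^sup>2 / (1 - sin (\<tau> * l)))"
        using sn l by (simp add: \<beta>_def power2_eq_square)
      also have "\<dots> = - (1 + sin (\<tau> * l))" unfolding s2 using sn by simp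
      finally have b: "\<beta> * l * cos (\<tau> * l) = - (1 + sin (\<tau> * l))" .
      have "\<beta> * (l * l) + l * cos (\<tau> * l) = \<beta> * (l * (l * sin (\<tau> * l)))"
        using c by algebra
      moreover have "l + (l * sin (\<tau> * l) + \<beta> * (l * (l * cos (\<tau> * l)))) = 0"
        using b by algebra
      ultimately show ?thesis using that unfolding e h_def
        by (auto simp: complex_eq_iff algebra_simps)
    qed
    thus ?thesis using hn unfolding P_def F_def by (simp add: field_simps)
  qed
  \<comment> \<open>Two successive divided differences, at \<open>l\<close> and then at
    \<open>- l\<close>, each completed by a derivative at its node. They extend
    \<open>P z / (z^2 - l^2)\<close> holomorphically across both zeros of the denominator.\<close>
  define Q1 where "Q1 z = (if z = of_real l then deriv P (of_real l)
                           else (P z - P (of_real l)) / (z - of_real l))" for z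
  define Q2 where "Q2 z = (if z = - of_real l then deriv Q1 (- of_real l)
                           else (Q1 z - Q1 (- of_real l)) / (z - (- of_real l)))" for z
  have "Q1 holomorphic_on U"
    unfolding Q1_def using pole_lemma_open[OF hol_P openU] .
  hence hol_Q2: "Q2 holomorphic_on U"
    unfolding Q2_def by (rule pole_lemma_open[OF _ openU])
  have Q2: "Q2 z = P z / (z\<^sup>2 - (of_real l)\<^sup>2)" if "z \<noteq> of_real l" "z \<noteq> - of_real l" for z
  proof -
    have "z + of_real l \<noteq> 0" using that(2) by (simp add: add_eq_0_iff2)
    moreover have "Q1 (- of_real l) = 0"
      using P0[of l] P0[of "-l"] l by (simp add: Q1_def)
    ultimately show ?thesis using that P0[of l]
      by (simp add: Q2_def Q1_def field_simps power2_eq_square)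
  qed
  \<comment> \<open>The first term has its only pole at \<open>- \<i> * l\<close>, below the half
    plane, and cancels the \<open>1 / z\<close> part of \<open>- Q2\<close>.\<close>
  define \<Theta> where "\<Theta> z = of_real \<beta> / (of_real l - \<i> * z) - Q2 z" for z
  have lz: "of_real l - \<i> * z \<noteq> 0" if "Im z \<ge> 0" for z
  proof
    assume "of_real l - \<i> * z = 0"
    hence "Re (of_real l - \<i> * z) = 0" by simp
    thus False using l that by simp
  qed
  have hol: "\<Theta> holomorphic_on {z. Im z \<ge> 0}"
    unfolding \<Theta>_def using lz
    by (intro holomorphic_intros holomorphic_on_subset[OF hol_Q2 hU]) auto
  have conv: "convex {z. Im z \<ge> 0}" using convex_halfspace_Im_ge[of 0] by simp

  define N where "N x = (cmod (h (of_real x)))\<^sup>2" for x :: real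
  have Npos: "N x > 0" for x
    using subsetD[OF hU, of "of_real x"] unfolding N_def U_def by simp
  \<comment> \<open>The term \<open>\<i> * \<beta> * x\<close> is purely imaginary, and
    \<open>Re ((A + B) / (A - B))\<close> is the difference of the squared moduli of
    \<open>A\<close> and \<open>B\<close> over that of \<open>A - B\<close>.\<close>
  have ReP: "Re (P (of_real x)) = (l\<^sup>2 - x\<^sup>2) / N x" for x
  proof -
    define A where "A = of_real l * exp (\<i> * of_real \<tau> * of_real x)"
    define B where "B = \<i> * complex_of_real x"
    have A2: "(cmod A)\<^sup>2 = l\<^sup>2" and B2: "(cmod B)\<^sup>2 = x\<^sup>2"
      by (simp_all add: A_def B_def norm_mult power_mult_distrib)
    have "Re ((A + B) / (A - B)) = Re ((A + B) * cnj (A - B)) / (cmod (A - B))\<^sup>2"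
      by (metis complex_div_cnj Re_divide_of_real of_real_power)
    also have "Re ((A + B) * cnj (A - B)) = (cmod A)\<^sup>2 - (cmod B)\<^sup>2"
      unfolding cmod_power2 by (simp add: algebra_simps power2_eq_square)
    finally show ?thesis
      unfolding A2 B2 by (simp add: P_def F_def h_def N_def A_def B_def)
  qed
  have Re\<Theta>: "Re (\<Theta> (of_real x)) = \<beta> * (l / (l\<^sup>2 + x\<^sup>2)) + 1 / N x"
    if x: "x \<noteq> l" "x \<noteq> - l" for x
  proof -
    have xl: "x\<^sup>2 - l\<^sup>2 \<noteq> 0" using x by (simp add: power2_eq_iff)
    have "complex_of_real x \<noteq> of_real l" "complex_of_real x \<noteq> - of_real l"
      using x by (auto simp: complex_eq_iff)
    hence "Q2 (of_real x) = P (of_real x) / of_real (x\<^sup>2 - l\<^sup>2)" using Q2 by simp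
    hence "Re (Q2 (of_real x)) = ((l\<^sup>2 - x\<^sup>2) / N x) / (x\<^sup>2 - l\<^sup>2)"
      by (simp only: Re_divide_of_real ReP)
    also have "\<dots> = - 1 / N x" using xl Npos[of x] by (simp add: field_simps)
    finally have "Re (Q2 (of_real x)) = - 1 / N x" .
    moreover have "Re (of_real \<beta> / (of_real l - \<i> * of_real x)) = \<beta> * (l / (l\<^sup>2 + x\<^sup>2))"
      by (simp add: Re_divide)
    ultimately show ?thesis by (simp add: \<Theta>_def)
  qed
  have contN: "continuous_on UNIV (\<lambda>x. 1 / N x)"
  proof -
    have "continuous_on UNIV N" unfolding N_def h_def by (intro continuous_intros)
    moreover have "N x \<noteq> 0" for x using Npos[of x] by simp
    ultimately show ?thesis by (intro continuous_intros) auto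
  qed
  \<comment> \<open>Each 3 bounds a quotient \<open>(w + \<i> * z) / (w - \<i> * z)\<close> with
    \<open>cmod w \<le> l\<close> and \<open>cmod z \<ge> 2 * l\<close>; one comes from
    \<open>F\<close>, the other from the compensated linear term.\<close>
  define C where "C = 3 + 3 * \<bar>\<beta>\<bar> * l"
  have C: "0 \<le> C" using l by (simp add: C_def)
  have arc: "cmod (\<Theta> z) \<le> C / (R\<^sup>2 - l\<^sup>2)" if R: "2 * l \<le> R" and z: "cmod z = R" "Im z \<ge> 0" for R z
  proof -
    have Rl: "R > l" using R l by simp
    hence Rl2: "R\<^sup>2 - l\<^sup>2 > 0" using l by (simp add: power_strict_mono)
    have zn: "z \<noteq> of_real l" "z \<noteq> - of_real l" using z Rl l by auto
    define A where "A = of_real l * exp (\<i> * of_real \<tau> * z)"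
    have A: "cmod A \<le> l" using l t z by (simp add: A_def norm_mult mult_le_cancel_left1)
    have quot: "cmod ((w + \<i> * z) / (w - \<i> * z)) \<le> 3" if w: "cmod w \<le> l" for w
    proof -
      have n: "cmod (w + \<i> * z) \<le> l + R"
        using norm_triangle_ineq[of w "\<i> * z"] w z by (simp add: norm_mult)
      have d: "R - l \<le> cmod (w - \<i> * z)"
        using norm_triangle_ineq3[of w "\<i> * z"] w z by (simp add: norm_mult)
      have "cmod (w + \<i> * z) \<le> 3 * cmod (w - \<i> * z)" using n d R by linarith
      moreover have "cmod (w - \<i> * z) > 0" using d Rl by linarith
      ultimately show ?thesis by (simp add: norm_divide divide_le_eq)
    qed
    have sq: "(of_real l)\<^sup>2 - z\<^sup>2 \<noteq> 0"
      using zn by (simp add: power2_eq_iff) (metis minus_minus)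
    have sqn: "R\<^sup>2 - l\<^sup>2 \<le> cmod ((of_real l)\<^sup>2 - z\<^sup>2)"
      using norm_triangle_ineq3[of "(of_real l)\<^sup>2" "z\<^sup>2"] z l by (simp add: norm_power)
    \<comment> \<open>Over the common denominator the growth of \<open>\<i> * \<beta> * z\<close>
      disappears: what replaces it is bounded, so \<open>\<Theta>\<close> decays quadratically on
      the arc.\<close>
    have "\<Theta> z = (F z + of_real (\<beta> * l) * ((of_real l + \<i> * z) / (of_real l - \<i> * z))) / ((of_real l)\<^sup>2 - z\<^sup>2)"
    proof -
      define D where "D = (of_real l)\<^sup>2 - z\<^sup>2"
      define q where "q = of_real l - \<i> * z"
      have q: "q \<noteq> 0" using lz[OF z(2)] by (simp add: q_def)
      have D: "D \<noteq> 0" using sq by (simp add: D_def)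
      have "z\<^sup>2 - (of_real l)\<^sup>2 = - D" by (simp add: D_def)
      hence "Q2 z = - (P z / D)" using Q2[OF zn] by simp
      hence "\<Theta> z = of_real \<beta> / q + (F z + \<i> * of_real \<beta> * z) / D"
        by (simp add: \<Theta>_def P_def q_def)
      also have "\<dots> = (F z + of_real \<beta> * ((D + \<i> * z * q) / q)) / D"
        using q D by (simp add: field_simps)
      also have "D + \<i> * z * q = of_real l * (of_real l + \<i> * z)"
        by (simp add: D_def q_def algebra_simps power2_eq_square)
      finally show ?thesis by (simp add: D_def q_def mult.assoc)
    qed
    hence "cmod (\<Theta> z) = cmod (F z + of_real (\<beta> * l) * ((of_real l + \<i> * z) / (of_real l - \<i> * z))) / cmod ((of_real l)\<^sup>2 - z\<^sup>2)"
      by (simp only: norm_divide)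
    also have "\<dots> \<le> C / (R\<^sup>2 - l\<^sup>2)"
    proof (rule frac_le[OF C _ Rl2 sqn])
      have "cmod (F z) \<le> 3" using quot[OF A] by (simp add: F_def h_def A_def)
      moreover have "cmod (of_real (\<beta> * l) * ((of_real l + \<i> * z) / (of_real l - \<i> * z))) \<le> (\<bar>\<beta>\<bar> * l) * 3"
      proof -
        have "cmod (of_real (\<beta> * l)) = \<bar>\<beta>\<bar> * l" using l by (simp add: norm_mult)
        thus ?thesis using quot[of "of_real l"] l
          by (simp only: norm_mult) (intro mult_left_mono, auto)
      qed
      ultimately show "cmod (F z + of_real (\<beta> * l) * ((of_real l + \<i> * z) / (of_real l - \<i> * z))) \<le> C"
        unfolding C_def by (intro order_trans[OF norm_triangle_ineq]) linarith
    qed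
    finally show ?thesis .
  qed
  \<comment> \<open>By Cauchy's theorem on the half disc of radius \<open>R\<close> the segment and
    the arc cancel, and the arc contributes at most its length \<open>pi * R\<close> times the bound
    \<open>arc\<close>. The segment may run through \<open>l\<close> and \<open>- l\<close>, as
    \<open>\<Theta>\<close> is regular there.\<close>
  have main: "\<bar>integral {-R..R} (\<lambda>x. 1 / N x) + \<beta> * (2 * arctan (R / l))\<bar> \<le> C / (R\<^sup>2 - l\<^sup>2) * R * pi"
    if R: "2 * l \<le> R" for R
  proof -
    have R0: "R > 0" using R l by simp
    have Rl2: "R\<^sup>2 - l\<^sup>2 > 0" using l R by (simp add: power_strict_mono)
    define p where "p = part_circlepath 0 R 0 pi"
    have pim: "path_image p \<subseteq> {z. Im z \<ge> 0}"
      unfolding p_def using R0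
      by (auto simp: path_image_part_circlepath Im_exp intro!: mult_nonneg_nonneg sin_ge_zero)
    have lim: "path_image (linepath (of_real (-R)) (of_real R)) \<subseteq> {z. Im z \<ge> 0}"
      unfolding path_image_linepath by (intro closed_segment_subset conv) auto
    have pf: "pathfinish (linepath (of_real (-R)) (of_real R)) = pathstart p"
      "pathfinish p = pathstart (linepath (of_real (-R)) (of_real R))"
      by (simp_all add: p_def)
    have cont: "continuous_on {z. Im z \<ge> 0} \<Theta>" using hol by (rule holomorphic_on_imp_continuous_on)
    have i1: "\<Theta> contour_integrable_on linepath (of_real (-R)) (of_real R)"
      using lim by (intro contour_integrable_continuous_linepath continuous_on_subset[OF cont])
        (simp add: path_image_linepath)
    have i2: "\<Theta> contour_integrable_on p"
      unfolding p_def by (intro contour_integrable_continuous_part_circlepath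
          continuous_on_subset[OF cont]) (use pim in \<open>simp add: p_def\<close>)
    define I where "I = contour_integral (linepath (of_real (-R)) (of_real R)) \<Theta>"
    define J where "J = contour_integral p \<Theta>"
    have "(\<Theta> has_contour_integral 0) (linepath (of_real (-R)) (of_real R) +++ p)"
      using pim lim pf
      by (intro Cauchy_theorem_convex_simple[OF hol conv])
        (auto simp: path_image_join p_def valid_path_join)
    moreover have "(\<Theta> has_contour_integral (I + J)) (linepath (of_real (-R)) (of_real R) +++ p)"
      using i1 i2 unfolding I_def J_def
      by (intro has_contour_integral_join has_contour_integral_integral) (auto simp: p_def)
    ultimately have IJ: "I + J = 0" using contour_integral_unique by metis
    have "norm J \<le> C / (R\<^sup>2 - l\<^sup>2) * R * (pi - 0)"
    proof (rule has_contour_integral_bound_part_circlepath)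
      show "(\<Theta> has_contour_integral J) (part_circlepath 0 R 0 pi)"
        using i2 unfolding J_def p_def by (rule has_contour_integral_integral)
      show "cmod (\<Theta> x) \<le> C / (R\<^sup>2 - l\<^sup>2)" if "x \<in> path_image (part_circlepath 0 R 0 pi)" for x
        using in_path_image_part_circlepath[OF that] pim that R0
        by (intro arc[OF R]) (auto simp: p_def)
    qed (use C Rl2 R0 in auto)
    hence J: "\<bar>Re J\<bar> \<le> C / (R\<^sup>2 - l\<^sup>2) * R * pi" using abs_Re_le_cmod[of J] by simp
    have "(\<Theta> has_contour_integral I) (linepath (of_real (-R)) (of_real R))"
      using i1 unfolding I_def by (rule has_contour_integral_integral)
    hence "((\<lambda>x. \<Theta> (of_real x)) has_integral I) {-R..R}"
      using R0 by (subst (asm) has_contour_integral_linepath_Reals_iff) auto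
    hence "((\<lambda>x. Re (\<Theta> (of_real x))) has_integral Re I) {-R..R}"
      by (rule has_integral_Re)
    \<comment> \<open>The formula for the real part was derived away from \<open>l\<close> and
      \<open>- l\<close>, two points that do not affect the integral.\<close>
    hence a: "((\<lambda>x. \<beta> * (l / (l\<^sup>2 + x\<^sup>2)) + 1 / N x) has_integral Re I) {-R..R}"
      by (rule has_integral_spike_finite[of "{l, -l}", rotated 2]) (auto simp: Re\<Theta>)
    have b: "((\<lambda>x. 1 / N x) has_integral integral {-R..R} (\<lambda>x. 1 / N x)) {-R..R}"
      by (intro integrable_integral integrable_continuous_real continuous_on_subset[OF contN] subset_UNIV)
    have "((\<lambda>x. \<beta> * (l / (l\<^sup>2 + x\<^sup>2)) + 1 / N x) has_integral
        (\<beta> * (2 * arctan (R / l)) + integral {-R..R} (\<lambda>x. 1 / N x))) {-R..R}"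
      using R0 l by (intro has_integral_add has_integral_mult_right has_integral_lorentzian b) auto
    with a have "Re I = \<beta> * (2 * arctan (R / l)) + integral {-R..R} (\<lambda>x. 1 / N x)"
      by (rule has_integral_unique)
    moreover have "Re I = - Re J" using IJ by (metis add_eq_0_iff2 uminus_complex.sel(1))
    ultimately show ?thesis using J by simp
  qed
  have "((\<lambda>R. integral {-R..R} (\<lambda>x. 1 / N x) + \<beta> * (2 * arctan (R / l))) \<longlongrightarrow> 0) at_top"
  proof (rule Lim_null_comparison)
    show "\<forall>\<^sub>F R in at_top. norm (integral {-R..R} (\<lambda>x. 1 / N x) + \<beta> * (2 * arctan (R / l)))
            \<le> C / (R\<^sup>2 - l\<^sup>2) * R * pi"
      using main by (intro eventually_at_top_linorderI[of "2 * l"]) simp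
    show "((\<lambda>R. C / (R\<^sup>2 - l\<^sup>2) * R * pi) \<longlongrightarrow> 0) at_top" by real_asymp
  qed
  moreover have "((\<lambda>R. \<beta> * (2 * arctan (R / l))) \<longlongrightarrow> \<beta> * (2 * (pi / 2))) at_top"
    using l by (intro tendsto_intros filterlim_compose[OF tendsto_arctan_at_top]) real_asymp
  ultimately have "((\<lambda>R. (integral {-R..R} (\<lambda>x. 1 / N x) + \<beta> * (2 * arctan (R / l)))
       - \<beta> * (2 * arctan (R / l))) \<longlongrightarrow> 0 - \<beta> * (2 * (pi / 2))) at_top"
    by (rule tendsto_diff)
  hence "((\<lambda>R. integral {-R..R} (\<lambda>x. 1 / N x)) \<longlongrightarrow> pi * cos (\<tau> * l) / (l * (1 - sin (\<tau> * l)))) at_top"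
    by (simp add: \<beta>_def mult.commute)
  from has_integral_UNIV_of_symmetric_limit[OF contN _ this]
  have "((\<lambda>x. 1 / N x) has_integral pi * cos (\<tau> * l) / (l * (1 - sin (\<tau> * l)))) UNIV"
    using Npos less_imp_le by (metis zero_le_divide_1_iff)
  thus ?thesis by (simp add: N_def h_def)
qed

section \<open>Orthonormal eigenbases of symmetric matrices\<close>

definition orthonormal_basis :: "(real^'n) set \<Rightarrow> bool" where
  "orthonormal_basis B \<longleftrightarrow> finite B \<and> (\<forall>u\<in>B. \<forall>v\<in>B. u \<bullet> v = (if u = v then 1 else 0)) \<and> span B = UNIV"

text \<open>Eigenvalues are attached to basis vectors, so that a sum over the basis counts each
  eigenvalue with its multiplicity.\<close>

definition eigenbasis :: "real^'n^'n \<Rightarrow> (real^'n) set \<Rightarrow> (real^'n \<Rightarrow> real) \<Rightarrow> bool" where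
  "eigenbasis A B lam \<longleftrightarrow> orthonormal_basis B \<and> (\<forall>v\<in>B. A *v v = lam v *\<^sub>R v)"

lemma eigenbasis_onb: "eigenbasis A B lam \<Longrightarrow> orthonormal_basis B"
  by (simp add: eigenbasis_def)

lemma eigenbasis_eigen: "eigenbasis A B lam \<Longrightarrow> v \<in> B \<Longrightarrow> A *v v = lam v *\<^sub>R v"
  by (simp add: eigenbasis_def)

lemma onb_finite: "orthonormal_basis B \<Longrightarrow> finite B"
  by (simp add: orthonormal_basis_def)

lemma onb_inner:
  "orthonormal_basis B \<Longrightarrow> u \<in> B \<Longrightarrow> v \<in> B \<Longrightarrow> u \<bullet> v = (if u = v then 1 else 0)"
  by (simp add: orthonormal_basis_def)

lemma onb_norm: "orthonormal_basis B \<Longrightarrow> v \<in> B \<Longrightarrow> norm v = 1"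
  by (simp add: norm_eq_1 onb_inner)

lemma onb_expand:
  assumes "orthonormal_basis B"
  shows "(\<Sum>v\<in>B. (x \<bullet> v) *\<^sub>R v) = x"
proof (rule orthonormal_basis_expand[OF _ onb_norm[OF assms] _ onb_finite[OF assms]])
  show "pairwise orthogonal B" "x \<in> span B"
    using assms by (auto simp: orthonormal_basis_def pairwise_def orthogonal_def)
qed

lemma onb_inner_expand:
  assumes "orthonormal_basis B"
  shows "(\<Sum>v\<in>B. (x \<bullet> v) * (y \<bullet> v)) = x \<bullet> y"
proof -
  have "x \<bullet> y = (\<Sum>v\<in>B. (x \<bullet> v) *\<^sub>R v) \<bullet> y" by (simp add: onb_expand[OF assms])
  also have "\<dots> = (\<Sum>v\<in>B. (x \<bullet> v) * (y \<bullet> v))"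
    unfolding inner_sum_left by (simp add: inner_commute[of y])
  finally show ?thesis by simp
qed

lemma onb_card:
  fixes B :: "(real^'n) set"
  assumes "orthonormal_basis B"
  shows "card B = CARD('n)"
proof -
  have "pairwise orthogonal B"
    using assms by (auto simp: orthonormal_basis_def pairwise_def orthogonal_def)
  moreover have "0 \<notin> B" using onb_norm[OF assms, of 0] by auto
  ultimately have "independent B" by (rule pairwise_orthogonal_independent)
  hence "card B = dim (UNIV :: (real^'n) set)"
    using assms by (intro dim_unique[symmetric]) (auto simp: orthonormal_basis_def)
  thus ?thesis by simp
qed

lemma onb_matrix_eqI:
  fixes X Y :: "real^'n^'n"
  assumes "orthonormal_basis B" "\<And>v. v \<in> B \<Longrightarrow> X *v v = Y *v v"
  shows "X = Y"
  unfolding matrix_eq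
proof
  fix x
  have "X *v x = X *v (\<Sum>v\<in>B. (x \<bullet> v) *\<^sub>R v)" by (simp add: onb_expand[OF assms(1)])
  also have "\<dots> = Y *v (\<Sum>v\<in>B. (x \<bullet> v) *\<^sub>R v)"
    using assms(2) by (simp add: linear_sum[OF matrix_vector_mul_linear] matrix_vector_mult_scaleR)
  finally show "X *v x = Y *v x" by (simp add: onb_expand[OF assms(1)])
qed

section \<open>The spectral theorem for real symmetric matrices\<close>

lemma matrix_inner_symmetric:
  fixes A :: "real^'n^'n"
  assumes "transpose A = A"
  shows "x \<bullet> (A *v y) = (A *v x) \<bullet> y"
  using assms by (metis dot_lmul_matrix transpose_matrix_vector)

text \<open>A maximiser \<open>v\<close> of the quadratic form on the unit sphere of
  \<open>S\<close> is an eigenvector. Moving \<open>v\<close> along the residual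
  \<open>w = A v - m v\<close>, which stays in \<open>S\<close>, would otherwise increase the
  Rayleigh quotient to first order.\<close>

lemma symmetric_max_eigenvector:
  fixes A :: "real^'n^'n"
  assumes sym: "transpose A = A" and S: "subspace S" and inv: "\<And>x. x \<in> S \<Longrightarrow> A *v x \<in> S"
    and ne: "S \<noteq> {0}"
  shows "\<exists>v\<in>S. \<exists>m. norm v = 1 \<and> A *v v = m *\<^sub>R v"
proof -
  obtain a where a: "a \<in> S" "a \<noteq> 0" using ne subspace_0[OF S] by auto
  define K where "K = S \<inter> sphere 0 1"
  have "compact K" unfolding K_def using closed_subspace[OF S]
    by (simp add: closed_Int_compact)
  moreover have "(1 / norm a) *\<^sub>R a \<in> K" unfolding K_def using a S by (simp add: subspace_scale)
  moreover have "continuous_on K (\<lambda>x. x \<bullet> (A *v x))"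
    by (intro continuous_intros)
  ultimately obtain v where v: "v \<in> K" and max: "\<And>x. x \<in> K \<Longrightarrow> x \<bullet> (A *v x) \<le> v \<bullet> (A *v v)"
    using continuous_attains_sup[of K "\<lambda>x. x \<bullet> (A *v x)"] by blast
  define m where "m = v \<bullet> (A *v v)"
  have vS: "v \<in> S" and vn: "norm v = 1" using v by (auto simp: K_def)
  have le: "x \<bullet> (A *v x) \<le> m * (x \<bullet> x)" if x: "x \<in> S" for x
  proof (cases "x = 0")
    case False
    have "(1 / norm x) *\<^sub>R x \<in> K" unfolding K_def using x S False by (simp add: subspace_scale)
    from max[OF this] have "(x \<bullet> (A *v x)) / (norm x)\<^sup>2 \<le> m"
      by (simp add: m_def matrix_vector_mult_scaleR power2_eq_square)
    thus ?thesis using False by (simp add: divide_le_eq power2_norm_eq_inner)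
  qed simp
  define w where "w = A *v v - m *\<^sub>R v"
  have wS: "w \<in> S" unfolding w_def using S vS inv by (simp add: subspace_diff subspace_scale)
  define c where "c = w \<bullet> (A *v w) - m * (w \<bullet> w)"
  have key: "2 * t * (w \<bullet> w) + t\<^sup>2 * c \<le> 0" for t
  proof -
    have "v + t *\<^sub>R w \<in> S" using S vS wS by (simp add: subspace_add subspace_scale)
    from le[OF this]
    have ineq: "(v + t *\<^sub>R w) \<bullet> (A *v (v + t *\<^sub>R w)) \<le> m * ((v + t *\<^sub>R w) \<bullet> (v + t *\<^sub>R w))" .
    have e1: "(v + t *\<^sub>R w) \<bullet> (A *v (v + t *\<^sub>R w)) =
        m + 2 * t * (w \<bullet> (A *v v)) + t\<^sup>2 * (w \<bullet> (A *v w))"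
      using matrix_inner_symmetric[OF sym, of v w]
      by (simp add: matrix_vector_right_distrib matrix_vector_mult_scaleR inner_add_left inner_add_right
          m_def power2_eq_square inner_commute algebra_simps)
    have e2: "(v + t *\<^sub>R w) \<bullet> (v + t *\<^sub>R w) = 1 + 2 * t * (w \<bullet> v) + t\<^sup>2 * (w \<bullet> w)"
      using vn by (simp add: inner_add_left inner_add_right norm_eq_1 power2_eq_square inner_commute algebra_simps)
    have "w \<bullet> w = w \<bullet> (A *v v - m *\<^sub>R v)" by (simp only: w_def)
    hence e3: "w \<bullet> (A *v v) = w \<bullet> w + m * (w \<bullet> v)" by (simp add: inner_diff_right)
    show ?thesis using ineq unfolding e1 e2 e3 c_def by (simp add: algebra_simps)
  qed
  have "w \<bullet> w = 0"
  proof (rule ccontr)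
    assume "w \<bullet> w \<noteq> 0"
    hence p: "w \<bullet> w > 0" using inner_ge_zero[of w] by linarith
    \<comment> \<open>Small enough that the quadratic term \<open>t^2 * c\<close> in
      \<open>key\<close> cannot outweigh the linear one.\<close>
    define t where "t = (w \<bullet> w) / (\<bar>c\<bar> + 1)"
    have t: "t > 0" using p by (simp add: t_def)
    have "t * \<bar>c\<bar> \<le> w \<bullet> w"
      using p by (simp add: t_def divide_le_eq)
    moreover have "t * (- \<bar>c\<bar>) \<le> t * c" using t by (intro mult_left_mono) auto
    ultimately have "- (w \<bullet> w) \<le> t * c" by simp
    hence "0 < 2 * (w \<bullet> w) + t * c" using p by linarith
    hence "0 < t * (2 * (w \<bullet> w) + t * c)" using t by simp
    thus False using key[of t] by (simp add: algebra_simps power2_eq_square)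
  qed
  hence "A *v v = m *\<^sub>R v" by (simp add: w_def)
  thus ?thesis using vS vn by blast
qed

text \<open>Induction on the dimension: split off one unit eigenvector; by symmetry its orthogonal
  complement inside \<open>S\<close> is again invariant. Invariant subspaces, rather than the whole
  space, make the induction possible.\<close>

lemma symmetric_subspace_eigenbasis:
  fixes A :: "real^'n^'n"
  assumes sym: "transpose A = A"
  shows "subspace S \<Longrightarrow> (\<And>x. x \<in> S \<Longrightarrow> A *v x \<in> S) \<Longrightarrow>
     \<exists>B lam. finite B \<and> B \<subseteq> S \<and> (\<forall>u\<in>B. \<forall>v\<in>B. u \<bullet> v = (if u = v then 1 else 0)) \<and> S \<subseteq> span B \<and>
       (\<forall>v\<in>B. A *v v = lam v *\<^sub>R v)"
proof (induction "dim S" arbitrary: S rule: less_induct)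
  case less
  show ?case
  proof (cases "S = {0}")
    case True
    thus ?thesis by (intro exI[of _ "{}"]) auto
  next
    case False
    then obtain v m where v: "v \<in> S" "norm v = 1" "A *v v = m *\<^sub>R v"
      using symmetric_max_eigenvector[OF sym less.prems] by blast
    have vv: "v \<bullet> v = 1" using v by (simp add: norm_eq_1)
    define S' where "S' = {x \<in> S. x \<bullet> v = 0}"
    have subS': "subspace S'"
      using less.prems(1) by (auto simp: S'_def subspace_def inner_add_left)
    have inv': "A *v x \<in> S'" if "x \<in> S'" for x
      using that less.prems(2) matrix_inner_symmetric[OF sym, of x v] v
      by (auto simp: S'_def)
    have "v \<notin> S'" using vv by (simp add: S'_def)
    moreover have "S' \<subseteq> S" by (auto simp: S'_def)
    ultimately have "S' \<subset> S" using v(1) by blast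
    hence "dim S' < dim S"
      using subS' less.prems(1) by (intro dim_psubset) (simp add: span_eq_iff[THEN iffD2])
    from less.hyps[OF this subS' inv'] obtain B lam where
      B: "finite B" "B \<subseteq> S'" "\<forall>u\<in>B. \<forall>v\<in>B. u \<bullet> v = (if u = v then 1 else 0)" "S' \<subseteq> span B"
         "\<forall>v\<in>B. A *v v = lam v *\<^sub>R v" by blast
    have vB: "v \<notin> B" using B(2) vv by (auto simp: S'_def)
    have orth: "u \<bullet> v = 0" "v \<bullet> u = 0" if "u \<in> B" for u
      using B(2) that by (auto simp: S'_def inner_commute)
    have "S \<subseteq> span (insert v B)"
    proof
      fix x assume x: "x \<in> S"
      have "x - (x \<bullet> v) *\<^sub>R v \<in> S'"
        using x v vv less.prems(1) by (simp add: S'_def subspace_diff subspace_scale inner_diff_left)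
      hence "x - (x \<bullet> v) *\<^sub>R v \<in> span B" using B(4) by blast
      thus "x \<in> span (insert v B)" by (auto simp: span_insert)
    qed
    thus ?thesis using B v vv orth vB
      by (intro exI[of _ "insert v B"] exI[of _ "lam(v := m)"]) (auto simp: S'_def)
  qed
qed

theorem symmetric_eigenbasis_exists:
  fixes A :: "real^'n^'n"
  assumes "transpose A = A"
  obtains B lam where "eigenbasis A B lam"
proof -
  obtain B lam where "finite B" "\<forall>u\<in>B. \<forall>v\<in>B. u \<bullet> v = (if u = v then 1 else 0)"
    "UNIV \<subseteq> span B" "\<forall>v\<in>B. A *v v = lam v *\<^sub>R v"
    using symmetric_subspace_eigenbasis[OF assms, of UNIV] by auto
  hence "eigenbasis A B lam"
    unfolding eigenbasis_def orthonormal_basis_def by blast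
  thus ?thesis by (rule that)
qed

text \<open>A nonzero \<open>x\<close> has a nonzero coordinate along some \<open>v\<close> in the
  basis, and moving \<open>A\<close> across the inner product \<open>x \<bullet> v\<close> forces
  the two eigenvalues to agree.\<close>

lemma eigenbasis_eigenvalue_cases:
  assumes eb: "eigenbasis A B lam" and sym: "transpose A = A" and x: "x \<noteq> 0" "A *v x = c *\<^sub>R x"
  obtains v where "v \<in> B" "lam v = c" "x \<bullet> v \<noteq> 0"
proof -
  have "\<exists>v\<in>B. x \<bullet> v \<noteq> 0"
  proof (rule ccontr)
    assume "\<not> (\<exists>v\<in>B. x \<bullet> v \<noteq> 0)"
    hence "(\<Sum>v\<in>B. (x \<bullet> v) *\<^sub>R v) = 0" by simp
    thus False using x by (simp add: onb_expand[OF eigenbasis_onb[OF eb]])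
  qed
  then obtain v where v: "v \<in> B" "x \<bullet> v \<noteq> 0" by blast
  have "c * (x \<bullet> v) = (A *v x) \<bullet> v" by (simp add: x)
  also have "\<dots> = lam v * (x \<bullet> v)"
    using matrix_inner_symmetric[OF sym, of x v] eigenbasis_eigen[OF eb v(1)] by simp
  finally show ?thesis using v that by simp
qed

text \<open>Makes the maximum in \<open>lambda_max\<close> one over a finite set, hence an upper
  bound for every \<open>lam v\<close>.\<close>

lemma eigenvalues_eigenbasis:
  assumes "eigenbasis A B lam" "transpose A = A"
  shows "eigenvalues A = lam ` B"
proof
  show "eigenvalues A \<subseteq> lam ` B"
    unfolding eigenvalues_def by (auto elim!: eigenbasis_eigenvalue_cases[OF assms])
  show "lam ` B \<subseteq> eigenvalues A"
  proof
    fix c assume "c \<in> lam ` B"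
    then obtain v where v: "v \<in> B" "c = lam v" by blast
    hence "v \<noteq> 0" using onb_norm[OF eigenbasis_onb[OF assms(1)], of v] by auto
    thus "c \<in> eigenvalues A" using v eigenbasis_eigen[OF assms(1) v(1)] by (auto simp: eigenvalues_def)
  qed
qed

section \<open>Matrices diagonal in an orthonormal basis\<close>

text \<open>The functional calculus of a diagonalised matrix, the sum of \<open>g v\<close> times
  the projection onto \<open>v\<close>. The coefficients range over any real normed field, so that
  the real Laplacian and the complex transfer matrix share one set of rules.\<close>

definition spectral_mat :: "(real^'n) set \<Rightarrow> (real^'n \<Rightarrow> 'a::{real_normed_field}) \<Rightarrow> 'a^'n^'n" where
  "spectral_mat B g = (\<chi> i j. \<Sum>v\<in>B. g v * of_real (v $ i * v $ j))"

lemma spectral_mat_cong: "(\<And>v. v \<in> B \<Longrightarrow> g v = h v) \<Longrightarrow> spectral_mat B g = spectral_mat B h"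
  by (simp add: spectral_mat_def)

text \<open>Summing over the inner index produces \<open>v \<bullet> u\<close>, and orthonormality
  leaves only the diagonal terms. Matrix algebra thereby becomes pointwise algebra of
  coefficients.\<close>

lemma spectral_mat_mult:
  assumes "orthonormal_basis B"
  shows "spectral_mat B g ** spectral_mat B h = spectral_mat B (\<lambda>v. g v * h v)"
proof -
  have "(\<Sum>k\<in>UNIV. (\<Sum>v\<in>B. g v * of_real (v $ i * v $ k)) * (\<Sum>u\<in>B. h u * of_real (u $ k * u $ j)))
      = (\<Sum>v\<in>B. g v * h v * of_real (v $ i * v $ j))" for i j
  proof -
    have "(\<Sum>k\<in>UNIV. (\<Sum>v\<in>B. g v * of_real (v $ i * v $ k)) * (\<Sum>u\<in>B. h u * of_real (u $ k * u $ j)))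
      = (\<Sum>k\<in>UNIV. \<Sum>v\<in>B. \<Sum>u\<in>B. g v * h u * of_real (v $ i * u $ j) * of_real (v $ k * u $ k))"
      unfolding sum_product by (intro sum.cong refl) (simp add: mult_ac)
    also have "\<dots> = (\<Sum>v\<in>B. \<Sum>u\<in>B. \<Sum>k\<in>UNIV. g v * h u * of_real (v $ i * u $ j) * of_real (v $ k * u $ k))"
      by (subst sum.swap, rule sum.cong[OF refl], subst sum.swap, rule refl)
    also have "\<dots> = (\<Sum>v\<in>B. \<Sum>u\<in>B. g v * h u * of_real (v $ i * u $ j) * of_real (v \<bullet> u))"
      by (simp add: inner_vec_def flip: sum_distrib_left)
    also have "\<dots> = (\<Sum>v\<in>B. \<Sum>u\<in>B. if v = u then g v * h u * of_real (v $ i * u $ j) else 0)"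
      by (intro sum.cong refl) (simp add: onb_inner[OF assms])
    also have "\<dots> = (\<Sum>v\<in>B. g v * h v * of_real (v $ i * v $ j))"
      by (simp add: onb_finite[OF assms])
    finally show ?thesis .
  qed
  thus ?thesis by (simp add: spectral_mat_def matrix_matrix_mult_def)
qed

text \<open>Parseval's identity for two coordinate vectors is the resolution of the
  identity.\<close>

lemma spectral_mat_const:
  fixes c :: "'a::real_normed_field"
  assumes "orthonormal_basis (B :: (real^'n) set)"
  shows "spectral_mat B (\<lambda>_. c) = mat c"
proof -
  have "(\<Sum>v\<in>B. v $ i * v $ j) = (if i = j then 1 else 0)" for i j :: 'n
    using onb_inner_expand[OF assms, of "axis i 1" "axis j 1"]
    by (simp add: inner_axis') (simp add: axis_def)
  hence "(\<Sum>v\<in>B. c * of_real (v $ i * v $ j)) = (if i = j then c else 0)" for i j :: 'n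
    unfolding sum_distrib_left[symmetric] of_real_sum[symmetric] by simp
  thus ?thesis by (simp add: spectral_mat_def mat_def)
qed

lemma spectral_mat_transpose: "transpose (spectral_mat B g) = spectral_mat B g"
  by (simp add: spectral_mat_def transpose_def mult.commute)

lemma spectral_mat_add: "spectral_mat B g + spectral_mat B h = spectral_mat B (\<lambda>v. g v + h v)"
  by (simp add: spectral_mat_def vec_eq_iff sum.distrib distrib_right)

lemma spectral_mat_diff: "spectral_mat B g - spectral_mat B h = spectral_mat B (\<lambda>v. g v - h v)"
  by (simp add: spectral_mat_def vec_eq_iff sum_subtractf left_diff_distrib)

lemma spectral_mat_scaleR: "c *\<^sub>R spectral_mat B g = spectral_mat B (\<lambda>v. c *\<^sub>R g v)"
  by (simp add: spectral_mat_def vec_eq_iff scaleR_sum_right)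

lemma spectral_mat_trace:
  assumes "orthonormal_basis B"
  shows "trace (spectral_mat B g) = (\<Sum>v\<in>B. g v)"
proof -
  have "trace (spectral_mat B g) = (\<Sum>v\<in>B. g v * of_real (v \<bullet> v))"
    unfolding trace_def spectral_mat_def
    by (simp, subst sum.swap) (simp add: inner_vec_def sum_distrib_left)
  also have "\<dots> = (\<Sum>v\<in>B. g v)" by (intro sum.cong refl) (simp add: onb_inner[OF assms])
  finally show ?thesis .
qed

lemma spectral_mat_mult_vec:
  fixes g :: "real^'n \<Rightarrow> real"
  shows "spectral_mat B g *v x = (\<Sum>v\<in>B. (g v * (v \<bullet> x)) *\<^sub>R v)"
proof -
  have "(\<Sum>j\<in>UNIV. (\<Sum>v\<in>B. g v * (v $ i * v $ j)) * x $ j) = (\<Sum>v\<in>B. g v * (v \<bullet> x) * v $ i)" for i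
    unfolding sum_distrib_right
    by (subst sum.swap) (simp add: inner_vec_def sum_distrib_left sum_distrib_right mult_ac)
  thus ?thesis by (simp add: spectral_mat_def matrix_vector_mult_def vec_eq_iff)
qed

lemma spectral_mat_quadratic_form:
  fixes g :: "real^'n \<Rightarrow> real"
  shows "x \<bullet> (spectral_mat B g *v x) = (\<Sum>v\<in>B. g v * (x \<bullet> v)\<^sup>2)"
  by (simp add: spectral_mat_mult_vec inner_sum_right power2_eq_square inner_commute[of x] mult_ac)

lemma spectral_mat_eqI:
  fixes X :: "real^'n^'n"
  assumes "orthonormal_basis B" "\<And>v. v \<in> B \<Longrightarrow> X *v v = g v *\<^sub>R v"
  shows "X = spectral_mat B g"
proof (rule onb_matrix_eqI[OF assms(1)])
  fix v assume v: "v \<in> B"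
  have "(\<Sum>u\<in>B. (g u * (u \<bullet> v)) *\<^sub>R u) = (\<Sum>u\<in>B. if u = v then g u *\<^sub>R u else 0)"
    using v by (intro sum.cong refl) (simp add: onb_inner[OF assms(1)])
  also have "\<dots> = g v *\<^sub>R v" using v by (simp add: onb_finite[OF assms(1)])
  finally show "X *v v = spectral_mat B g *v v"
    using assms(2)[OF v] by (simp add: spectral_mat_mult_vec)
qed

lemma eigenbasis_spectral_mat: "eigenbasis A B lam \<Longrightarrow> A = spectral_mat B lam"
  by (rule spectral_mat_eqI) (auto simp: eigenbasis_def)

lemma cmat_spectral_mat: "cmat (spectral_mat B g) = spectral_mat B (\<lambda>v. of_real (g v))"
  by (simp add: cmat_def spectral_mat_def)

lemma conj_transpose_spectral_mat:
  "conj_transpose (spectral_mat B g) = spectral_mat B (\<lambda>v. cnj (g v))"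
  by (simp add: conj_transpose_def spectral_mat_def mult.commute)

section \<open>Inverses, pseudo-inverses, cosine and sine of diagonalised matrices\<close>

lemma matrix_inv_eqI:
  fixes A :: "'a::field^'n^'n"
  assumes "A ** C = mat 1" "C ** A = mat 1"
  shows "matrix_inv A = C"
proof -
  have "A ** matrix_inv A = mat 1 \<and> matrix_inv A ** A = mat 1"
    unfolding matrix_inv_def by (rule someI[of _ C]) (use assms in auto)
  thus ?thesis using assms by (metis matrix_mul_assoc matrix_mul_lid matrix_mul_rid)
qed

lemma matrix_inv_spectral_mat:
  assumes "orthonormal_basis B" "\<And>v. v \<in> B \<Longrightarrow> g v \<noteq> 0"
  shows "matrix_inv (spectral_mat B g) = spectral_mat B (\<lambda>v. 1 / g v)"
proof (rule matrix_inv_eqI)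
  have "spectral_mat B (\<lambda>v. g v * (1 / g v)) = spectral_mat B (\<lambda>_. 1)"
       "spectral_mat B (\<lambda>v. 1 / g v * g v) = spectral_mat B (\<lambda>_. 1)"
    using assms(2) by (auto intro!: spectral_mat_cong)
  thus "spectral_mat B g ** spectral_mat B (\<lambda>v. 1 / g v) = mat 1"
       "spectral_mat B (\<lambda>v. 1 / g v) ** spectral_mat B g = mat 1"
    by (simp_all only: spectral_mat_mult[OF assms(1)] spectral_mat_const[OF assms(1)])
qed

text \<open>Transposing \<open>X Y = (X Z) (X Y)\<close> reverses the symmetric factors and yields
  \<open>X Y = X Z\<close>; likewise \<open>Y X = Z X\<close>. Then
  \<open>Y = Y X Y = Z X Y = Z X Z = Z\<close>. This justifies the definite description in
  \<open>pinv\<close>.\<close>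

lemma Moore_Penrose_unique:
  fixes X Y Z :: "real^'n^'n"
  assumes Y: "X ** Y ** X = X" "Y ** X ** Y = Y" "transpose (X ** Y) = X ** Y" "transpose (Y ** X) = Y ** X"
    and Z: "X ** Z ** X = X" "Z ** X ** Z = Z" "transpose (X ** Z) = X ** Z" "transpose (Z ** X) = Z ** X"
  shows "Y = Z"
proof -
  have "X ** Y = (X ** Z) ** (X ** Y)" by (metis Z(1) matrix_mul_assoc)
  hence "X ** Y = transpose ((X ** Z) ** (X ** Y))" using Y(3) by simp
  also have "\<dots> = (X ** Y) ** (X ** Z)" using Y(3) Z(3) by (simp add: matrix_transpose_mul)
  also have "\<dots> = X ** Z" by (metis Y(1) matrix_mul_assoc)
  finally have XY: "X ** Y = X ** Z" .
  have "Y ** X = (Y ** X) ** (Z ** X)" by (metis Z(1) matrix_mul_assoc)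
  hence "Y ** X = transpose ((Y ** X) ** (Z ** X))" using Y(4) by simp
  also have "\<dots> = (Z ** X) ** (Y ** X)" using Y(4) Z(4) by (simp add: matrix_transpose_mul)
  also have "\<dots> = Z ** X" by (metis Y(1) matrix_mul_assoc)
  finally have YX: "Y ** X = Z ** X" .
  have "Y = Y ** X ** Y" using Y(2) by simp
  also have "\<dots> = Z ** (X ** Y)" unfolding YX by (simp add: matrix_mul_assoc)
  also have "\<dots> = Z" unfolding XY using Z(2) by (simp add: matrix_mul_assoc)
  finally show ?thesis .
qed

text \<open>The convention \<open>inverse 0 = 0\<close> is exactly how the pseudo-inverse treats the
  kernel, so the four defining equations hold coefficient by coefficient.\<close>

lemma pinv_spectral_mat:
  fixes g :: "real^'n \<Rightarrow> real"
  assumes "orthonormal_basis B"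
  shows "pinv (spectral_mat B g) = spectral_mat B (\<lambda>v. inverse (g v))"
proof -
  let ?X = "spectral_mat B g" and ?Y = "spectral_mat B (\<lambda>v. inverse (g v))"
  have "x * inverse x * x = x" "inverse x * x * inverse x = inverse x" for x :: real
    by (cases "x = 0"; simp)+
  hence *: "?X ** ?Y ** ?X = ?X" "?Y ** ?X ** ?Y = ?Y"
    unfolding spectral_mat_mult[OF assms] by (simp_all only:)
  have "transpose (?X ** ?Y) = ?X ** ?Y" "transpose (?Y ** ?X) = ?Y ** ?X"
    unfolding spectral_mat_mult[OF assms] by (simp_all add: spectral_mat_transpose)
  with * show ?thesis unfolding pinv_def
    by (intro the_equality) (auto intro: Moore_Penrose_unique)
qed

lemma mpow_spectral_mat:
  fixes g :: "real^'n \<Rightarrow> real"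
  assumes "orthonormal_basis B"
  shows "mpow (spectral_mat B g) k = spectral_mat B (\<lambda>v. g v ^ k)"
  by (induction k) (simp_all add: spectral_mat_mult[OF assms] spectral_mat_const[OF assms])

text \<open>For a fixed basis the matrix is a finite combination of fixed matrices, linear in the
  coefficients, so scalar series can be summed inside it.\<close>

lemma spectral_mat_sums:
  fixes f :: "nat \<Rightarrow> real^'n \<Rightarrow> real"
  assumes "\<And>v. v \<in> B \<Longrightarrow> (\<lambda>k. f k v) sums s v"
  shows "(\<lambda>k. spectral_mat B (f k)) sums spectral_mat B s"
proof -
  have *: "spectral_mat B h = (\<Sum>v\<in>B. h v *\<^sub>R (\<chi> i j. v $ i * v $ j))" for h :: "real^'n \<Rightarrow> real"
    by (simp add: spectral_mat_def vec_eq_iff)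
  show ?thesis unfolding * using assms
    by (intro sums_sum bounded_linear.sums[OF bounded_linear_scaleR_left])
qed

lemma mat_cos_spectral_mat:
  assumes "orthonormal_basis B"
  shows "mat_cos (spectral_mat B g) = spectral_mat B (\<lambda>v. cos (g v))"
proof -
  have "(\<lambda>k. ((-1)^k / fact (2*k)) * x ^ (2*k)) sums cos x" for x :: real
    using cos_paired[of x] by simp
  hence "(\<lambda>k. spectral_mat B (\<lambda>v. ((-1)^k / fact (2*k)) *\<^sub>R g v ^ (2*k))) sums spectral_mat B (\<lambda>v. cos (g v))"
    by (intro spectral_mat_sums) simp
  thus ?thesis unfolding mat_cos_def mpow_spectral_mat[OF assms] spectral_mat_scaleR
    by (rule sums_unique[symmetric])
qed

lemma mat_sin_spectral_mat:
  assumes "orthonormal_basis B"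
  shows "mat_sin (spectral_mat B g) = spectral_mat B (\<lambda>v. sin (g v))"
proof -
  have "(\<lambda>k. ((-1)^k / fact (2*k+1)) * x ^ (2*k+1)) sums sin x" for x :: real
    using sin_paired[of x] by simp
  hence "(\<lambda>k. spectral_mat B (\<lambda>v. ((-1)^k / fact (2*k+1)) *\<^sub>R g v ^ (2*k+1))) sums spectral_mat B (\<lambda>v. sin (g v))"
    by (intro spectral_mat_sums) simp
  thus ?thesis unfolding mat_sin_def mpow_spectral_mat[OF assms] spectral_mat_scaleR
    by (rule sums_unique[symmetric])
qed

section \<open>Spectral sums under rank-one updates\<close>

lemma outer_mult_vec: "outer a b *v x = (b \<bullet> x) *\<^sub>R a"
  by (simp add: outer_def matrix_vector_mult_def vec_eq_iff inner_vec_def sum_distrib_left mult_ac)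

text \<open>Evaluate \<open>v \<bullet> ((A + \<delta> a a^T) u)\<close> in two ways. In particular,
  if \<open>a \<bullet> v = 0\<close>, then \<open>v\<close> overlaps only with those
  \<open>u\<close> that have the same eigenvalue.\<close>

lemma rank_one_update_eigenpair:
  fixes A :: "real^'n^'n"
  assumes sym: "transpose A = A" and v: "A *v v = l *\<^sub>R v"
    and u: "(A + \<delta> *\<^sub>R outer a a) *v u = \<mu> *\<^sub>R u"
  shows "(v \<bullet> u) * (\<mu> - l) = \<delta> * (a \<bullet> v) * (a \<bullet> u)"
proof -
  have "\<mu> * (v \<bullet> u) = v \<bullet> ((A + \<delta> *\<^sub>R outer a a) *v u)" by (simp add: u)
  also have "\<dots> = v \<bullet> (A *v u) + \<delta> * (a \<bullet> u) * (v \<bullet> a)"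
    by (simp add: matrix_vector_mult_add_rdistrib scaleR_matrix_vector_assoc[symmetric]
        outer_mult_vec inner_add_right)
  also have "v \<bullet> (A *v u) = l * (v \<bullet> u)" using matrix_inner_symmetric[OF sym, of v u] v by simp
  finally show ?thesis by (simp add: algebra_simps inner_commute)
qed

lemma onb_sum_squares:
  assumes "orthonormal_basis B"
  shows "(\<Sum>v\<in>B. (v \<bullet> x)\<^sup>2) = x \<bullet> x"
  using onb_inner_expand[OF assms, of x x] by (simp add: power2_eq_square inner_commute)

text \<open>Otherwise the squared relation for eigenpairs, summed over the basis, would give
  \<open>(\<delta> * (a \<bullet> a))^2 < \<delta>^2 * (a \<bullet> u)^2 * (a \<bullet> a)\<close>,
  against Cauchy-Schwarz. The overlap \<open>v \<bullet> u \<noteq> 0\<close> is recorded because it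
  lets the relation decide the case \<open>a \<bullet> v = 0\<close> later.\<close>

lemma rank_one_update_eigenvalue_near:
  fixes A :: "real^'n^'n"
  assumes eb: "eigenbasis A B lam" and sym: "transpose A = A" and un: "norm u = 1"
    and u: "(A + \<delta> *\<^sub>R outer a a) *v u = \<mu> *\<^sub>R u"
  obtains v where "v \<in> B" "v \<bullet> u \<noteq> 0" "\<bar>\<mu> - lam v\<bar> \<le> \<bar>\<delta>\<bar> * (a \<bullet> a)"
proof (rule ccontr)
  assume "\<not> thesis"
  hence far: "\<bar>\<mu> - lam v\<bar> > \<bar>\<delta>\<bar> * (a \<bullet> a)" if "v \<in> B" "v \<bullet> u \<noteq> 0" for v
    using that \<open>\<And>v. v \<in> B \<Longrightarrow> v \<bullet> u \<noteq> 0 \<Longrightarrow> \<bar>\<mu> - lam v\<bar> \<le> \<bar>\<delta>\<bar> * (a \<bullet> a) \<Longrightarrow> thesis\<close> by force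
  note B = eigenbasis_onb[OF eb]
  have uu: "u \<bullet> u = 1" using un by (simp add: norm_eq_1)
  have farsq: "(\<delta> * (a \<bullet> a))\<^sup>2 < (\<mu> - lam v)\<^sup>2" if "v \<in> B" "v \<bullet> u \<noteq> 0" for v
    using power_strict_mono[OF far[OF that], of 2] by (simp add: power_mult_distrib)
  have "\<exists>v\<in>B. v \<bullet> u \<noteq> 0"
  proof (rule ccontr)
    assume "\<not> ?thesis"
    hence "(\<Sum>v\<in>B. (v \<bullet> u)\<^sup>2) = 0" by simp
    thus False using onb_sum_squares[OF B, of u] uu by simp
  qed
  then obtain v0 where v0: "v0 \<in> B" "v0 \<bullet> u \<noteq> 0" by blast
  have "(\<Sum>v\<in>B. (v \<bullet> u)\<^sup>2 * (\<delta> * (a \<bullet> a))\<^sup>2) < (\<Sum>v\<in>B. (v \<bullet> u)\<^sup>2 * (\<mu> - lam v)\<^sup>2)"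
  proof (rule sum_strict_mono_ex1[OF onb_finite[OF B]])
    show "\<forall>v\<in>B. (v \<bullet> u)\<^sup>2 * (\<delta> * (a \<bullet> a))\<^sup>2 \<le> (v \<bullet> u)\<^sup>2 * (\<mu> - lam v)\<^sup>2"
    proof
      fix v assume v: "v \<in> B"
      show "(v \<bullet> u)\<^sup>2 * (\<delta> * (a \<bullet> a))\<^sup>2 \<le> (v \<bullet> u)\<^sup>2 * (\<mu> - lam v)\<^sup>2"
      proof (cases "v \<bullet> u = 0")
        case False
        show ?thesis using farsq[OF v False] by (intro mult_left_mono) auto
      qed simp
    qed
    have "(v0 \<bullet> u)\<^sup>2 * (\<delta> * (a \<bullet> a))\<^sup>2 < (v0 \<bullet> u)\<^sup>2 * (\<mu> - lam v0)\<^sup>2"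
      using farsq[OF v0] v0(2) by (intro mult_strict_left_mono) auto
    thus "\<exists>v\<in>B. (v \<bullet> u)\<^sup>2 * (\<delta> * (a \<bullet> a))\<^sup>2 < (v \<bullet> u)\<^sup>2 * (\<mu> - lam v)\<^sup>2"
      using v0(1) by blast
  qed
  also have "\<dots> = (\<Sum>v\<in>B. (\<delta> * (a \<bullet> u))\<^sup>2 * (v \<bullet> a)\<^sup>2)"
  proof (intro sum.cong refl)
    fix v assume "v \<in> B"
    have "(v \<bullet> u)\<^sup>2 * (\<mu> - lam v)\<^sup>2 = (\<delta> * (a \<bullet> v) * (a \<bullet> u))\<^sup>2"
      using rank_one_update_eigenpair[OF sym eigenbasis_eigen[OF eb \<open>v \<in> B\<close>] u] by (metis power_mult_distrib)
    thus "(v \<bullet> u)\<^sup>2 * (\<mu> - lam v)\<^sup>2 = (\<delta> * (a \<bullet> u))\<^sup>2 * (v \<bullet> a)\<^sup>2"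
      by (simp add: power_mult_distrib inner_commute[of v a])
  qed
  also have "\<dots> = \<delta>\<^sup>2 * (a \<bullet> u)\<^sup>2 * (a \<bullet> a)"
    by (simp add: onb_sum_squares[OF B] power_mult_distrib flip: sum_distrib_left)
  also have "\<dots> \<le> \<delta>\<^sup>2 * (a \<bullet> a) * (a \<bullet> a)"
    using Cauchy_Schwarz_ineq[of a u] uu by (intro mult_mono) auto
  also have "\<dots> = (\<Sum>v\<in>B. (v \<bullet> u)\<^sup>2 * (\<delta> * (a \<bullet> a))\<^sup>2)"
    unfolding sum_distrib_right[symmetric] onb_sum_squares[OF B] uu
    by (simp add: power2_eq_square mult_ac)
  finally show False by simp
qed

text \<open>An exact identity for any coefficients \<open>D\<close>. The weights
  \<open>(v \<bullet> u)^2\<close> are doubly stochastic, which reproduces both spectral sums, and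
  the eigenpair relation turns the linear part into the first order term.\<close>

lemma spectral_sum_remainder:
  fixes A :: "real^'n^'n" and F :: "real \<Rightarrow> real"
  assumes eb: "eigenbasis A B lam" and sym: "transpose A = A"
    and eu: "eigenbasis (A + \<delta> *\<^sub>R outer a a) U mu"
  shows "(\<Sum>u\<in>U. F (mu u)) - (\<Sum>v\<in>B. F (lam v)) - \<delta> * (\<Sum>v\<in>B. D v * (a \<bullet> v)\<^sup>2)
       = (\<Sum>u\<in>U. \<Sum>v\<in>B. (v \<bullet> u)\<^sup>2 * (F (mu u) - F (lam v) - D v * (mu u - lam v)))"
proof -
  note B = eigenbasis_onb[OF eb] and U = eigenbasis_onb[OF eu]
  have 1: "(\<Sum>u\<in>U. \<Sum>v\<in>B. (v \<bullet> u)\<^sup>2 * F (mu u)) = (\<Sum>u\<in>U. F (mu u))"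
    unfolding sum_distrib_right[symmetric] onb_sum_squares[OF B]
    by (intro sum.cong refl) (simp add: onb_inner[OF U])
  have 2: "(\<Sum>u\<in>U. \<Sum>v\<in>B. (v \<bullet> u)\<^sup>2 * F (lam v)) = (\<Sum>v\<in>B. F (lam v))"
  proof (subst sum.swap, intro sum.cong refl)
    fix v assume v: "v \<in> B"
    have "(\<Sum>u\<in>U. (v \<bullet> u)\<^sup>2 * F (lam v)) = (\<Sum>u\<in>U. (u \<bullet> v)\<^sup>2) * F (lam v)"
      by (simp add: sum_distrib_right inner_commute)
    thus "(\<Sum>u\<in>U. (v \<bullet> u)\<^sup>2 * F (lam v)) = F (lam v)"
      using v by (simp add: onb_sum_squares[OF U] onb_inner[OF B])
  qed
  have 3: "(\<Sum>u\<in>U. \<Sum>v\<in>B. (v \<bullet> u)\<^sup>2 * (D v * (mu u - lam v))) = \<delta> * (\<Sum>v\<in>B. D v * (a \<bullet> v)\<^sup>2)"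
    unfolding sum_distrib_left
  proof (subst sum.swap, intro sum.cong refl)
    fix v assume v: "v \<in> B"
    \<comment> \<open>One factor \<open>v \<bullet> u\<close> absorbs \<open>mu u - lam v\<close>;
      the other remains and pairs with \<open>a \<bullet> u\<close> to give
      \<open>v \<bullet> a\<close> by Parseval.\<close>
    have "(v \<bullet> u)\<^sup>2 * (D v * (mu u - lam v)) = \<delta> * D v * (a \<bullet> v) * ((v \<bullet> u) * (a \<bullet> u))" if "u \<in> U" for u
    proof -
      have "(v \<bullet> u)\<^sup>2 * (D v * (mu u - lam v)) = D v * (v \<bullet> u) * ((v \<bullet> u) * (mu u - lam v))"
        by (simp add: power2_eq_square)
      thus ?thesis
        unfolding rank_one_update_eigenpair[OF sym eigenbasis_eigen[OF eb v] eigenbasis_eigen[OF eu that]]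
        by (simp only: mult_ac)
    qed
    hence "(\<Sum>u\<in>U. (v \<bullet> u)\<^sup>2 * (D v * (mu u - lam v)))
        = \<delta> * D v * (a \<bullet> v) * (\<Sum>u\<in>U. (v \<bullet> u) * (a \<bullet> u))"
      unfolding sum_distrib_left by (rule sum.cong[OF refl])
    thus "(\<Sum>u\<in>U. (v \<bullet> u)\<^sup>2 * (D v * (mu u - lam v))) = \<delta> * (D v * (a \<bullet> v)\<^sup>2)"
      unfolding onb_inner_expand[OF U] by (simp add: power2_eq_square inner_commute[of v a])
  qed
  show ?thesis unfolding 1[symmetric] 2[symmetric] 3[symmetric] sum_subtractf[symmetric]
    by (intro sum.cong refl) (simp add: algebra_simps)
qed

section \<open>Estimates as the perturbation tends to zero\<close>

lemma eventually_abs_mult_less: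
  fixes c e :: real
  assumes "0 < e"
  shows "\<forall>\<^sub>F \<delta> in at 0. \<bar>\<delta>\<bar> * c < e"
proof -
  have "((\<lambda>\<delta>. \<bar>\<delta>\<bar> * c) \<longlongrightarrow> \<bar>0\<bar> * c) (at 0)" by (intro tendsto_intros)
  thus ?thesis using assms by (intro order_tendstoD(2)) auto
qed

text \<open>Every perturbed eigenvalue lies near an old one whose vector it overlaps. Continuity is
  asked for only where \<open>a \<bullet> v \<noteq> 0\<close>: the function used later jumps at the
  eigenvalue 0, but an eigenvalue near one with \<open>a \<bullet> v = 0\<close> is equal to
  it.\<close>

lemma rank_one_update_spectrum_bounded:
  fixes A :: "real^'n^'n" and F :: "real \<Rightarrow> real"
  assumes eb: "eigenbasis A B lam" and sym: "transpose A = A"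
    and cont: "\<And>v. v \<in> B \<Longrightarrow> a \<bullet> v \<noteq> 0 \<Longrightarrow> isCont F (lam v)"
  shows "\<exists>K\<ge>0. \<forall>\<^sub>F \<delta> in at 0. \<forall>u \<mu>. norm u = 1 \<longrightarrow> (A + \<delta> *\<^sub>R outer a a) *v u = \<mu> *\<^sub>R u \<longrightarrow>
           \<bar>F \<mu>\<bar> \<le> K \<and> \<bar>\<mu>\<bar> \<le> K"
proof -
  \<comment> \<open>The sum dominates each of its summands; the two units leave room for
    \<open>F \<mu>\<close> and \<open>\<mu>\<close> to differ by less than 1 from their values at
    \<open>lam v\<close>.\<close>
  define K where "K = (\<Sum>v\<in>B. \<bar>F (lam v)\<bar> + 1 + \<bar>lam v\<bar> + 1)"
  note finB = onb_finite[OF eigenbasis_onb[OF eb]]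
  have Kv: "\<bar>F (lam v)\<bar> + 1 + \<bar>lam v\<bar> + 1 \<le> K" if "v \<in> B" for v
    unfolding K_def using that finB by (intro member_le_sum) auto
  have "\<forall>\<^sub>F \<delta> in at 0. \<forall>v\<in>B. \<forall>\<mu>. \<bar>\<mu> - lam v\<bar> \<le> \<bar>\<delta>\<bar> * (a \<bullet> a) \<longrightarrow> (a \<bullet> v \<noteq> 0 \<or> \<mu> = lam v) \<longrightarrow>
          \<bar>F \<mu>\<bar> \<le> K \<and> \<bar>\<mu>\<bar> \<le> K"
  proof (intro eventually_ball_finite[OF finB] ballI)
    fix v assume v: "v \<in> B"
    obtain d where d: "d > 0" "\<And>\<mu>. a \<bullet> v \<noteq> 0 \<Longrightarrow> \<bar>\<mu> - lam v\<bar> < d \<Longrightarrow> \<bar>F \<mu> - F (lam v)\<bar> < 1"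
    proof (cases "a \<bullet> v = 0")
      case False
      thus ?thesis using cont[OF v False] that
        unfolding continuous_at_eps_delta dist_real_def by (metis zero_less_one)
    qed (use that[of 1] in auto)
    have "\<forall>\<^sub>F \<delta> in at 0. \<bar>\<delta>\<bar> * (a \<bullet> a) < min d 1"
      using d(1) by (intro eventually_abs_mult_less) auto
    thus "\<forall>\<^sub>F \<delta> in at 0. \<forall>\<mu>. \<bar>\<mu> - lam v\<bar> \<le> \<bar>\<delta>\<bar> * (a \<bullet> a) \<longrightarrow> (a \<bullet> v \<noteq> 0 \<or> \<mu> = lam v) \<longrightarrow>
          \<bar>F \<mu>\<bar> \<le> K \<and> \<bar>\<mu>\<bar> \<le> K"
    proof (rule eventually_mono, intro allI impI)
      fix \<delta> \<mu> assume *: "\<bar>\<delta>\<bar> * (a \<bullet> a) < min d 1" "\<bar>\<mu> - lam v\<bar> \<le> \<bar>\<delta>\<bar> * (a \<bullet> a)"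
        "a \<bullet> v \<noteq> 0 \<or> \<mu> = lam v"
      have "\<bar>F \<mu> - F (lam v)\<bar> < 1" using d(2)[of \<mu>] * by auto
      moreover have "\<bar>\<mu> - lam v\<bar> < 1" using * by linarith
      ultimately show "\<bar>F \<mu>\<bar> \<le> K \<and> \<bar>\<mu>\<bar> \<le> K" using Kv[OF v] by linarith
    qed
  qed
  hence "\<forall>\<^sub>F \<delta> in at 0. \<forall>u \<mu>. norm u = 1 \<longrightarrow> (A + \<delta> *\<^sub>R outer a a) *v u = \<mu> *\<^sub>R u \<longrightarrow>
           \<bar>F \<mu>\<bar> \<le> K \<and> \<bar>\<mu>\<bar> \<le> K"
  proof (rule eventually_mono, intro allI impI)
    fix \<delta> u \<mu>
    assume *: "\<forall>v\<in>B. \<forall>\<mu>. \<bar>\<mu> - lam v\<bar> \<le> \<bar>\<delta>\<bar> * (a \<bullet> a) \<longrightarrow> (a \<bullet> v \<noteq> 0 \<or> \<mu> = lam v) \<longrightarrow>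
          \<bar>F \<mu>\<bar> \<le> K \<and> \<bar>\<mu>\<bar> \<le> K"
      and un: "norm u = 1" and u: "(A + \<delta> *\<^sub>R outer a a) *v u = \<mu> *\<^sub>R u"
    obtain v where v: "v \<in> B" "v \<bullet> u \<noteq> 0" "\<bar>\<mu> - lam v\<bar> \<le> \<bar>\<delta>\<bar> * (a \<bullet> a)"
      using rank_one_update_eigenvalue_near[OF eb sym un u] .
    have "a \<bullet> v \<noteq> 0 \<or> \<mu> = lam v"
      using rank_one_update_eigenpair[OF sym eigenbasis_eigen[OF eb v(1)] u] v(2) by auto
    thus "\<bar>F \<mu>\<bar> \<le> K \<and> \<bar>\<mu>\<bar> \<le> K" using * v by blast
  qed
  moreover have "K \<ge> 0" unfolding K_def by (intro sum_nonneg) auto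
  ultimately show ?thesis by blast
qed

text \<open>Near \<open>l\<close> differentiability applies, with one overlap factor paying for
  \<open>\<mu> - l\<close>; far from \<open>l\<close> the squared overlap is of order
  \<open>\<delta>^2\<close>. The bound is uniform in \<open>u\<close> and \<open>\<mu>\<close> since
  an eigenbasis of the update is chosen afresh for each \<open>\<delta>\<close>.\<close>

lemma spectral_remainder_term_small:
  fixes A :: "real^'n^'n" and F :: "real \<Rightarrow> real"
  assumes sym: "transpose A = A" and v: "norm v = 1" "A *v v = l *\<^sub>R v"
    and der: "a \<bullet> v \<noteq> 0 \<Longrightarrow> (F has_real_derivative D) (at l)"
    and K: "K \<ge> 0" "\<forall>\<^sub>F \<delta> in at 0. \<forall>u \<mu>. norm u = 1 \<longrightarrow> (A + \<delta> *\<^sub>R outer a a) *v u = \<mu> *\<^sub>R u \<longrightarrow>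
           \<bar>F \<mu>\<bar> \<le> K \<and> \<bar>\<mu>\<bar> \<le> K"
    and \<epsilon>: "\<epsilon> > 0"
  shows "\<forall>\<^sub>F \<delta> in at 0. \<forall>u \<mu>. norm u = 1 \<longrightarrow> (A + \<delta> *\<^sub>R outer a a) *v u = \<mu> *\<^sub>R u \<longrightarrow>
           \<bar>(v \<bullet> u)\<^sup>2 * (F \<mu> - F l - D * (\<mu> - l))\<bar> \<le> \<epsilon> * \<bar>\<delta>\<bar>"
proof (cases "a \<bullet> v = 0")
  case True
  show ?thesis
  proof (rule always_eventually, intro allI impI)
    fix \<delta> :: real and u \<mu> assume "norm u = 1" and u: "(A + \<delta> *\<^sub>R outer a a) *v u = \<mu> *\<^sub>R u"
    have "v \<bullet> u = 0 \<or> \<mu> = l" using rank_one_update_eigenpair[OF sym v(2) u] True by auto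
    thus "\<bar>(v \<bullet> u)\<^sup>2 * (F \<mu> - F l - D * (\<mu> - l))\<bar> \<le> \<epsilon> * \<bar>\<delta>\<bar>" using \<epsilon> by auto
  qed
next
  case False
  define N where "N = a \<bullet> a"
  have N: "N \<ge> 0" by (simp add: N_def)
  \<comment> \<open>The added 1 keeps the denominator positive even if \<open>a\<close> has norm
    zero.\<close>
  define \<epsilon>' where "\<epsilon>' = \<epsilon> / (N + 1)"
  have \<epsilon>': "\<epsilon>' > 0" "\<epsilon>' * N \<le> \<epsilon>"
    using \<epsilon> N by (auto simp: \<epsilon>'_def field_simps)
  have "(F has_derivative (*) D) (at l)" using der[OF False] by (simp add: has_field_derivative_def)
  then obtain \<eta> where \<eta>: "\<eta> > 0" "\<And>\<mu>. \<bar>\<mu> - l\<bar> < \<eta> \<Longrightarrow> \<bar>F \<mu> - F l - D * (\<mu> - l)\<bar> \<le> \<epsilon>' * \<bar>\<mu> - l\<bar>"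
    unfolding has_derivative_at_alt real_norm_def using \<epsilon>'(1) by metis
  define K' where "K' = K + \<bar>F l\<bar> + \<bar>D\<bar> * (K + \<bar>l\<bar>)"
  \<comment> \<open>Chosen for the far case: there the term is at most
    \<open>\<bar>\<delta>\<bar>\<close> times this quantity.\<close>
  have "\<forall>\<^sub>F \<delta> in at 0. \<bar>\<delta>\<bar> * (K' * N\<^sup>2 / \<eta>\<^sup>2) < \<epsilon>" by (rule eventually_abs_mult_less[OF \<epsilon>])
  with K(2) show ?thesis
  proof eventually_elim
    case (elim \<delta>)
    show ?case
    proof (intro allI impI)
      fix u \<mu> assume un: "norm u = 1" and u: "(A + \<delta> *\<^sub>R outer a a) *v u = \<mu> *\<^sub>R u"
      note pair = rank_one_update_eigenpair[OF sym v(2) u]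
      have av: "\<bar>a \<bullet> v\<bar> \<le> norm a" and au: "\<bar>a \<bullet> u\<bar> \<le> norm a" and vu: "\<bar>v \<bullet> u\<bar> \<le> 1"
        using Cauchy_Schwarz_ineq2[of a v] Cauchy_Schwarz_ineq2[of a u] Cauchy_Schwarz_ineq2[of v u] un v(1)
        by auto
      have prod: "\<bar>a \<bullet> v\<bar> * \<bar>a \<bullet> u\<bar> \<le> N"
        using mult_mono[OF av au] by (simp add: N_def power2_norm_eq_inner[symmetric] power2_eq_square)
      have pabs: "\<bar>v \<bullet> u\<bar> * \<bar>\<mu> - l\<bar> \<le> \<bar>\<delta>\<bar> * N"
        using mult_left_mono[OF prod, of "\<bar>\<delta>\<bar>"] pair by (metis abs_mult abs_ge_zero mult.assoc)
      show "\<bar>(v \<bullet> u)\<^sup>2 * (F \<mu> - F l - D * (\<mu> - l))\<bar> \<le> \<epsilon> * \<bar>\<delta>\<bar>"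
      proof (cases "\<bar>\<mu> - l\<bar> < \<eta>")
        case True
        have "\<bar>(v \<bullet> u)\<^sup>2 * (F \<mu> - F l - D * (\<mu> - l))\<bar> \<le> (v \<bullet> u)\<^sup>2 * (\<epsilon>' * \<bar>\<mu> - l\<bar>)"
          unfolding abs_mult using \<eta>(2)[OF True] by (simp add: mult_left_mono)
        also have "\<dots> = \<epsilon>' * (\<bar>v \<bullet> u\<bar> * (\<bar>v \<bullet> u\<bar> * \<bar>\<mu> - l\<bar>))"
          by (subst power2_abs[symmetric]) (simp only: power2_eq_square mult_ac)
        also have "\<dots> \<le> \<epsilon>' * (1 * (\<bar>\<delta>\<bar> * N))"
          using \<epsilon>'(1) N by (intro mult_left_mono mult_mono vu pabs) auto
        also have "\<dots> \<le> \<epsilon> * \<bar>\<delta>\<bar>"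
          using mult_right_mono[OF \<epsilon>'(2), of "\<bar>\<delta>\<bar>"] by (simp add: mult_ac)
        finally show ?thesis .
      next
        case False
        have R: "\<bar>F \<mu> - F l - D * (\<mu> - l)\<bar> \<le> K'"
        proof -
          have "\<bar>F \<mu>\<bar> \<le> K" "\<bar>\<mu>\<bar> \<le> K" using elim(1) un u by auto
          moreover have "\<bar>D * (\<mu> - l)\<bar> \<le> \<bar>D\<bar> * (K + \<bar>l\<bar>)"
            unfolding abs_mult using \<open>\<bar>\<mu>\<bar> \<le> K\<close> by (intro mult_left_mono) auto
          ultimately show ?thesis unfolding K'_def by linarith
        qed
        have "\<bar>v \<bullet> u\<bar> * \<eta> \<le> \<bar>\<delta>\<bar> * N"
          using mult_left_mono[of \<eta> "\<bar>\<mu> - l\<bar>" "\<bar>v \<bullet> u\<bar>"] False pabs by linarith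
        hence "(\<bar>v \<bullet> u\<bar> * \<eta>)\<^sup>2 \<le> (\<bar>\<delta>\<bar> * N)\<^sup>2" using \<eta>(1) by (intro power_mono) auto
        hence sq: "(v \<bullet> u)\<^sup>2 \<le> \<delta>\<^sup>2 * N\<^sup>2 / \<eta>\<^sup>2" using \<eta>(1) by (simp add: power_mult_distrib field_simps)
        have "\<bar>(v \<bullet> u)\<^sup>2 * (F \<mu> - F l - D * (\<mu> - l))\<bar> \<le> (\<delta>\<^sup>2 * N\<^sup>2 / \<eta>\<^sup>2) * K'"
          unfolding abs_mult using sq R by (intro mult_mono) auto
        also have "\<dots> = \<bar>\<delta>\<bar> * (\<bar>\<delta>\<bar> * (K' * N\<^sup>2 / \<eta>\<^sup>2))"
          by (simp add: power2_eq_square)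
        also have "\<dots> \<le> \<bar>\<delta>\<bar> * \<epsilon>" using elim(2) by (intro mult_left_mono) auto
        finally show ?thesis by (simp add: mult.commute)
      qed
    qed
  qed
qed

text \<open>The remainder identity is a sum of finitely many terms, each \<open>o(\<delta>)\<close>.
  For each small \<open>\<delta>\<close> any eigenbasis representing \<open>S \<delta>\<close> will
  do; no continuous choice is made.\<close>

theorem has_derivative_spectral_sum_rank_one:
  fixes A :: "real^'n^'n" and F S :: "real \<Rightarrow> real"
  assumes eb: "eigenbasis A B lam" and sym: "transpose A = A"
    and der: "\<And>v. v \<in> B \<Longrightarrow> a \<bullet> v \<noteq> 0 \<Longrightarrow> (F has_real_derivative D v) (at (lam v))"
    and d0: "d0 > 0"
    and S: "\<And>\<delta>. \<bar>\<delta>\<bar> < d0 \<Longrightarrow> \<exists>U mu. eigenbasis (A + \<delta> *\<^sub>R outer a a) U mu \<and> S \<delta> = (\<Sum>u\<in>U. F (mu u))"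
  shows "(S has_real_derivative (\<Sum>v\<in>B. D v * (a \<bullet> v)\<^sup>2)) (at 0)"
proof -
  note B = eigenbasis_onb[OF eb]
  let ?D = "\<Sum>v\<in>B. D v * (a \<bullet> v)\<^sup>2"
  define n where "n = real CARD('n)"
  have n: "n > 0" by (simp add: n_def)
  obtain K where K: "K \<ge> 0" "\<forall>\<^sub>F \<delta> in at 0. \<forall>u \<mu>. norm u = 1 \<longrightarrow> (A + \<delta> *\<^sub>R outer a a) *v u = \<mu> *\<^sub>R u \<longrightarrow>
           \<bar>F \<mu>\<bar> \<le> K \<and> \<bar>\<mu>\<bar> \<le> K"
    using rank_one_update_spectrum_bounded[OF eb sym, of a F] der DERIV_isCont by blast
  \<comment> \<open>The basis supplied for \<open>\<delta> = 0\<close> may differ from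
    \<open>B\<close>. The remainder identity with zero coefficients shows that both give the same
    sum.\<close>
  have S0: "S 0 = (\<Sum>v\<in>B. F (lam v))"
  proof -
    obtain U mu where U: "eigenbasis (A + 0 *\<^sub>R outer a a) U mu" "S 0 = (\<Sum>u\<in>U. F (mu u))"
      using S[of 0] d0 by auto
    have "(v \<bullet> u)\<^sup>2 * (F (mu u) - F (lam v) - 0 * (mu u - lam v)) = 0" if "u \<in> U" "v \<in> B" for u v
      using rank_one_update_eigenpair[OF sym eigenbasis_eigen[OF eb that(2)] eigenbasis_eigen[OF U(1) that(1)]]
      by auto
    hence "(\<Sum>u\<in>U. \<Sum>v\<in>B. (v \<bullet> u)\<^sup>2 * (F (mu u) - F (lam v) - 0 * (mu u - lam v))) = 0"
      by (intro sum.neutral ballI)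
    thus ?thesis unfolding spectral_sum_remainder[OF eb sym U(1), of F "\<lambda>_. 0", symmetric] U(2) by simp
  qed
  have ev: "\<forall>\<^sub>F \<delta> in at 0. \<bar>S \<delta> - S 0 - ?D * \<delta>\<bar> \<le> e * \<bar>\<delta>\<bar>" if e: "e > 0" for e
  proof -
    \<comment> \<open>Both bases have \<open>n\<close> elements, so the double sum has
      \<open>n * n\<close> terms.\<close>
    define \<epsilon> where "\<epsilon> = e / (n * n)"
    have \<epsilon>: "\<epsilon> > 0" using e n by (simp add: \<epsilon>_def)
    have "\<forall>\<^sub>F \<delta> in at 0. \<forall>v\<in>B. \<forall>u \<mu>. norm u = 1 \<longrightarrow> (A + \<delta> *\<^sub>R outer a a) *v u = \<mu> *\<^sub>R u \<longrightarrow>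
           \<bar>(v \<bullet> u)\<^sup>2 * (F \<mu> - F (lam v) - D v * (\<mu> - lam v))\<bar> \<le> \<epsilon> * \<bar>\<delta>\<bar>"
      using spectral_remainder_term_small[OF sym onb_norm[OF B] eigenbasis_eigen[OF eb] der K \<epsilon>]
      by (intro eventually_ball_finite[OF onb_finite[OF B]]) blast
    moreover have "\<forall>\<^sub>F \<delta> in at 0. \<bar>\<delta>\<bar> < d0" using eventually_abs_mult_less[OF d0, of 1] by simp
    ultimately show ?thesis
    proof eventually_elim
      case (elim \<delta>)
      obtain U mu where U: "eigenbasis (A + \<delta> *\<^sub>R outer a a) U mu" "S \<delta> = (\<Sum>u\<in>U. F (mu u))"
        using S[OF elim(2)] by blast
      note Uo = eigenbasis_onb[OF U(1)]
      have "S \<delta> - S 0 - ?D * \<delta> =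
          (\<Sum>u\<in>U. \<Sum>v\<in>B. (v \<bullet> u)\<^sup>2 * (F (mu u) - F (lam v) - D v * (mu u - lam v)))"
        using spectral_sum_remainder[OF eb sym U(1), of F D] U(2) S0 by (simp add: mult.commute)
      also have "\<bar>\<dots>\<bar> \<le> (\<Sum>u\<in>U. \<Sum>v\<in>B. \<epsilon> * \<bar>\<delta>\<bar>)"
        using elim(1) onb_norm[OF Uo] eigenbasis_eigen[OF U(1)]
        by (intro order_trans[OF sum_abs] sum_mono) blast
      also have "\<dots> = e * \<bar>\<delta>\<bar>"
        using n by (simp add: onb_card[OF B] onb_card[OF Uo] \<epsilon>_def flip: n_def)
      finally show ?case .
    qed
  qed
  have "\<exists>d>0. \<forall>y. \<bar>y\<bar> < d \<longrightarrow> \<bar>S y - S 0 - ?D * y\<bar> \<le> e * \<bar>y\<bar>" if e: "e > 0" for e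
  proof -
    obtain d where d: "d > 0" "\<And>y. y \<noteq> 0 \<Longrightarrow> \<bar>y\<bar> < d \<Longrightarrow> \<bar>S y - S 0 - ?D * y\<bar> \<le> e * \<bar>y\<bar>"
      using ev[OF e] unfolding eventually_at dist_real_def by auto
    have "\<bar>S y - S 0 - ?D * y\<bar> \<le> e * \<bar>y\<bar>" if "\<bar>y\<bar> < d" for y
      using d(2)[of y] that by (cases "y = 0") auto
    thus ?thesis using d(1) by blast
  qed
  thus ?thesis
    unfolding has_field_derivative_def has_derivative_at_alt
    by (simp add: bounded_linear_mult_right)
qed

section \<open>Graph Laplacians and the consensus network\<close>

text \<open>The choice operator fixes an unknown orientation of the edge, hence an unknown sign,
  which cancels in the outer product.\<close>

lemma Edge_vec_cases:
  assumes "i \<noteq> j"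
  shows "Edge_vec {i, j} = Evec i j \<or> Edge_vec {i, j} = - Evec i j"
proof -
  define p where "p = (SOME p. {i, j} = {fst p, snd p} \<and> fst p \<noteq> snd p)"
  have "{i, j} = {fst p, snd p} \<and> fst p \<noteq> snd p"
    unfolding p_def by (rule someI[of _ "(i, j)"]) (use assms in simp)
  hence "(fst p = i \<and> snd p = j) \<or> (fst p = j \<and> snd p = i)" by (auto simp: doubleton_eq_iff)
  thus ?thesis by (auto simp: Edge_vec_def Evec_def Let_def p_def[symmetric])
qed

lemma outer_Edge_vec:
  assumes "i \<noteq> j"
  shows "outer (Edge_vec {i, j}) (Edge_vec {i, j}) = outer (Evec i j) (Evec i j)"
  using Edge_vec_cases[OF assms] by (auto simp: outer_def)

lemma laplacian_update:
  fixes E :: "'n::finite set set"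
  assumes "e \<in> E"
  shows "laplacian E (w(e := w e + \<delta>)) = laplacian E w + \<delta> *\<^sub>R outer (Edge_vec e) (Edge_vec e)"
proof -
  have "finite E" by simp
  have "laplacian E (w(e := w e + \<delta>)) =
      (\<Sum>x\<in>E. w x *\<^sub>R outer (Edge_vec x) (Edge_vec x)
        + (if x = e then \<delta> *\<^sub>R outer (Edge_vec x) (Edge_vec x) else 0))"
    unfolding laplacian_def by (intro sum.cong refl) (simp add: scaleR_left_distrib)
  thus ?thesis using assms \<open>finite E\<close> by (simp add: sum.distrib laplacian_def)
qed

lemma transpose_laplacian: "transpose (laplacian E w) = laplacian E w"
  by (simp add: laplacian_def transpose_def outer_def vec_eq_iff mult.commute)

lemma laplacian_mult_vec:
  "laplacian E w *v x = (\<Sum>e\<in>E. (w e * (Edge_vec e \<bullet> x)) *\<^sub>R Edge_vec e)"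
proof -
  have "laplacian E w *v x = (\<Sum>e\<in>E. (w e *\<^sub>R outer (Edge_vec e) (Edge_vec e)) *v x)"
    unfolding laplacian_def
    by (induction E rule: infinite_finite_induct) (simp_all add: matrix_vector_mult_add_rdistrib)
  thus ?thesis by (simp add: scaleR_matrix_vector_assoc[symmetric] outer_mult_vec)
qed

lemma laplacian_quadratic_form:
  "x \<bullet> (laplacian E w *v x) = (\<Sum>e\<in>E. w e * (Edge_vec e \<bullet> x)\<^sup>2)"
  by (simp add: laplacian_mult_vec inner_sum_right power2_eq_square inner_commute[of x] mult_ac)

lemma Evec_inner: "Evec i j \<bullet> x = x $ i - x $ j"
  by (simp add: Evec_def inner_diff_left inner_axis')

lemma connected_wgraph_edgeE:
  assumes "connected_wgraph E w" "e \<in> E"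
  obtains i j where "i \<noteq> j" "e = {i, j}"
  using assms unfolding connected_wgraph_def by blast

lemma Edge_vec_inner_eq_0_iff:
  assumes "i \<noteq> j"
  shows "Edge_vec {i, j} \<bullet> x = 0 \<longleftrightarrow> x $ i = x $ j"
  using Edge_vec_cases[OF assms] by (auto simp: Evec_inner)

lemma laplacian_ones:
  assumes "connected_wgraph E w"
  shows "laplacian E w *v (\<chi> i. c) = 0"
proof -
  have "Edge_vec e \<bullet> (\<chi> i. c) = 0" if "e \<in> E" for e
    using connected_wgraph_edgeE[OF assms that] Edge_vec_inner_eq_0_iff by (metis vec_lambda_beta)
  thus ?thesis by (simp add: laplacian_mult_vec)
qed

text \<open>The quadratic form is a sum of nonnegative edge terms, so all of them vanish;
  \<open>x\<close> is then equal at the ends of each edge and hence along every path.\<close>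

lemma laplacian_kernel:
  fixes E :: "'n::finite set set"
  assumes conn: "connected_wgraph E w" and x: "laplacian E w *v x = 0"
  shows "x $ a = x $ b"
proof -
  have wpos: "w e > 0" if "e \<in> E" for e using conn that by (simp add: connected_wgraph_def)
  have "(\<Sum>e\<in>E. w e * (Edge_vec e \<bullet> x)\<^sup>2) = 0"
    using laplacian_quadratic_form[of x E w] x by simp
  hence "\<forall>e\<in>E. w e * (Edge_vec e \<bullet> x)\<^sup>2 = 0"
    using wpos by (subst (asm) sum_nonneg_eq_0_iff) (auto simp: less_imp_le)
  hence z: "Edge_vec e \<bullet> x = 0" if "e \<in> E" for e using wpos[OF that] that by auto
  have step: "x $ c = x $ d" if "{c, d} \<in> E" for c d
    using z[OF that] Edge_vec_inner_eq_0_iff[of c d x] by (cases "c = d") auto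
  have "(\<lambda>x y. {x, y} \<in> E)\<^sup>*\<^sup>* a b" using conn by (simp add: connected_wgraph_def)
  thus ?thesis by (induction rule: rtranclp_induct) (auto simp: step)
qed

lemma laplacian_eigenvalue_nonneg:
  assumes "connected_wgraph E w" "norm v = 1" "laplacian E w *v v = l *\<^sub>R v"
  shows "0 \<le> l"
proof -
  have "v \<bullet> v = 1" using assms(2) by (simp add: norm_eq_1)
  hence "l = (\<Sum>e\<in>E. w e * (Edge_vec e \<bullet> v)\<^sup>2)"
    using laplacian_quadratic_form[of v E w] assms(3) by simp
  moreover have "\<forall>e\<in>E. w e > 0" using assms(1) by (simp add: connected_wgraph_def)
  ultimately show ?thesis by (simp add: sum_nonneg less_imp_le)
qed

section \<open>The centring matrix and the performance in an eigenbasis\<close>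

lemma Mn_mult_vec: "(Mn *v x) $ i = x $ i - (\<Sum>j\<in>UNIV. x $ j) / real CARD('n)"
  for x :: "real^'n"
proof -
  have "(Mn *v x) $ i = (\<Sum>j\<in>UNIV. (if i = j then x $ j else 0) - x $ j / real CARD('n))"
    unfolding Mn_def matrix_vector_mult_def
    by (simp, intro sum.cong refl) (simp add: left_diff_distrib)
  thus ?thesis by (simp add: sum_subtractf sum_divide_distrib)
qed

text \<open>Eigenvectors for 0 are constant by connectedness and are killed by centring; all others
  are orthogonal to the constants and are fixed by it.\<close>

lemma Mn_spectral_mat:
  fixes E :: "'n::finite set set"
  assumes conn: "connected_wgraph E w" and eb: "eigenbasis (laplacian E w) B lam"
  shows "Mn = spectral_mat B (\<lambda>v. if lam v = 0 then 0 else 1)"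
proof (rule spectral_mat_eqI[OF eigenbasis_onb[OF eb]])
  fix v assume v: "v \<in> B"
  note e = eigenbasis_eigen[OF eb v]
  show "Mn *v v = (if lam v = 0 then 0 else 1) *\<^sub>R v"
  proof (cases "lam v = 0")
    case True
    hence c: "v $ a = v $ b" for a b using laplacian_kernel[OF conn, of v a b] e by simp
    have mean: "(\<Sum>j\<in>UNIV. v $ j) / real CARD('n) = v $ i" for i
      by (subst sum.cong[OF refl c[of _ i]]) simp
    have "(Mn *v v) $ i = 0" for i unfolding Mn_mult_vec mean[of i] by simp
    thus ?thesis using True by (simp add: vec_eq_iff)
  next
    case False
    have "lam v * ((\<chi> i. 1) \<bullet> v) = (\<chi> i. 1) \<bullet> (laplacian E w *v v)" using e by simp
    also have "\<dots> = 0"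
      using matrix_inner_symmetric[OF transpose_laplacian, of "\<chi> i. 1" E w v] laplacian_ones[OF conn, of 1]
      by simp
    finally have "(\<Sum>j\<in>UNIV. v $ j) = 0" using False by (simp add: inner_vec_def)
    thus ?thesis using False by (simp add: vec_eq_iff Mn_mult_vec)
  qed
qed

text \<open>The eigenvalue 0 belongs to the consensus direction, which the output matrix removes.\<close>
definition mode_performance :: "real \<Rightarrow> real \<Rightarrow> real" where
  "mode_performance \<tau> l = (if l = 0 then 0 else cos (\<tau> * l) / (2 * l * (1 - sin (\<tau> * l))))"

text \<open>All matrices in the transfer function are diagonal in the eigenbasis, so the trace
  splits into one scalar frequency integral for each mode.\<close>

lemma rho_ss_eigenbasis:
  fixes E :: "'n::finite set set"
  assumes conn: "connected_wgraph E w" and eb: "eigenbasis (laplacian E w) B lam"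
    and t: "0 \<le> \<tau>" and tl: "\<And>v. v \<in> B \<Longrightarrow> \<tau> * lam v < pi / 2"
  shows "rho_ss (laplacian E w) \<tau> = (\<Sum>v\<in>B. mode_performance \<tau> (lam v))"
proof -
  note B = eigenbasis_onb[OF eb]
  define h where "h l x = of_real l * exp (\<i> * of_real \<tau> * of_real x) - \<i> * complex_of_real x" for l x
  define q where "q l x = (if l = 0 then 0 else 1 / (cmod (h l x))\<^sup>2)" for l x
  have nonneg: "0 \<le> lam v" if "v \<in> B" for v
    using laplacian_eigenvalue_nonneg[OF conn onb_norm[OF B that] eigenbasis_eigen[OF eb that]] .
  \<comment> \<open>Frequency 0 is left out because the matrix to be inverted is singular there: it
    reduces to the Laplacian.\<close>
  have trace_eq: "trace (conj_transpose (transfer (laplacian E w) \<tau> (\<i> * of_real x)) ** transfer (laplacian E w) \<tau> (\<i> * of_real x))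
      = of_real (\<Sum>v\<in>B. q (lam v) x)" if x: "x \<noteq> 0" for x
  proof -
    let ?g = "\<lambda>v. \<i> * of_real x + exp (- complex_of_real \<tau> * (\<i> * of_real x)) * of_real (lam v)"
    have gh: "?g v = cnj (h (lam v) x)" for v
      by (simp add: h_def exp_cnj mult_ac)
    have gn: "?g v \<noteq> 0" if "v \<in> B" for v
    proof (cases "lam v = 0")
      case True thus ?thesis using x by simp
    next
      case False
      hence "h (lam v) x \<noteq> 0" unfolding h_def
        using nonneg[OF that] t tl[OF that] by (intro delay_symbol_nonzero) auto
      thus ?thesis unfolding gh by simp
    qed
    have "transfer (laplacian E w) \<tau> (\<i> * of_real x)
        = spectral_mat B (\<lambda>v. of_real (if lam v = 0 then 0 else 1) * (1 / ?g v))"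
    proof -
      have "mat (\<i> * of_real x) + mat (exp (- complex_of_real \<tau> * (\<i> * of_real x))) ** cmat (laplacian E w)
          = spectral_mat B ?g"
        by (subst eigenbasis_spectral_mat[OF eb])
          (simp only: cmat_spectral_mat spectral_mat_const[OF B, symmetric] spectral_mat_mult[OF B] spectral_mat_add)
      thus ?thesis
        unfolding transfer_def
        by (simp only: matrix_inv_spectral_mat[OF B gn] Mn_spectral_mat[OF conn eb] cmat_spectral_mat spectral_mat_mult[OF B])
    qed
    hence "trace (conj_transpose (transfer (laplacian E w) \<tau> (\<i> * of_real x)) ** transfer (laplacian E w) \<tau> (\<i> * of_real x))
      = (\<Sum>v\<in>B. cnj (of_real (if lam v = 0 then 0 else 1) * (1 / ?g v)) * (of_real (if lam v = 0 then 0 else 1) * (1 / ?g v)))"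
      by (simp only: conj_transpose_spectral_mat spectral_mat_mult[OF B] spectral_mat_trace[OF B])
    also have "\<dots> = (\<Sum>v\<in>B. of_real (q (lam v) x))"
    proof (intro sum.cong refl)
      fix v assume "v \<in> B"
      have "cnj (1 / cnj z) * (1 / cnj z) = of_real (1 / (cmod z)\<^sup>2)" for z
        using complex_norm_square[of z] by simp
      thus "cnj (of_real (if lam v = 0 then 0 else 1) * (1 / ?g v)) * (of_real (if lam v = 0 then 0 else 1) * (1 / ?g v))
          = of_real (q (lam v) x)"
        unfolding gh q_def by simp
    qed
    finally show ?thesis by simp
  qed
  have q_int: "(q (lam v) has_integral 2 * pi * mode_performance \<tau> (lam v)) UNIV" if v: "v \<in> B" for v
  proof (cases "lam v = 0")
    case True
    thus ?thesis unfolding q_def mode_performance_def by simp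
  next
    case False
    hence "((\<lambda>x. 1 / (cmod (h (lam v) x))\<^sup>2) has_integral pi * cos (\<tau> * lam v) / (lam v * (1 - sin (\<tau> * lam v)))) UNIV"
      unfolding h_def using nonneg[OF v] t tl[OF v] by (intro delay_H2_integral_scalar) auto
    thus ?thesis using False unfolding q_def mode_performance_def by simp
  qed
  have "((\<lambda>x. \<Sum>v\<in>B. q (lam v) x) has_integral (\<Sum>v\<in>B. 2 * pi * mode_performance \<tau> (lam v))) UNIV"
    by (intro has_integral_sum onb_finite[OF B] q_int)
  hence "((\<lambda>x. complex_of_real (\<Sum>v\<in>B. q (lam v) x)) has_integral
      of_real (\<Sum>v\<in>B. 2 * pi * mode_performance \<tau> (lam v))) UNIV"
    by (rule has_integral_of_real)
  \<comment> \<open>The excluded frequency 0 is a single point and does not change the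
    integral.\<close>
  hence "((\<lambda>x. trace (conj_transpose (transfer (laplacian E w) \<tau> (\<i> * of_real x)) ** transfer (laplacian E w) \<tau> (\<i> * of_real x)))
      has_integral of_real (\<Sum>v\<in>B. 2 * pi * mode_performance \<tau> (lam v))) UNIV"
    by (rule has_integral_spike_finite[of "{0}", rotated 2]) (auto simp: trace_eq)
  hence "rho_ss (laplacian E w) \<tau> = 1 / (2 * pi) * (\<Sum>v\<in>B. 2 * pi * mode_performance \<tau> (lam v))"
    unfolding rho_ss_def by (subst integral_unique) auto
  thus ?thesis by (simp add: sum_distrib_left)
qed

section \<open>Derivative of a mode and the sensitivity formula\<close>

text \<open>In the quotient rule, \<open>cos^2 = (1 - sin) * (1 + sin)\<close> makes a factor
  \<open>1 - sin\<close> appear in the numerator and cancel. The result is written with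
  \<open>inverse\<close> to match the product of pseudo-inverses in the sensitivity formula.\<close>

lemma mode_performance_has_derivative:
  assumes "0 < l" "sin (\<tau> * l) < 1"
  shows "(mode_performance \<tau> has_real_derivative
     1 / 2 * (inverse (l * l) * (\<tau> * l - cos (\<tau> * l)) * inverse (1 - sin (\<tau> * l)))) (at l)"
proof -
  define s c where "s = sin (\<tau> * l)" and "c = cos (\<tau> * l)"
  have s: "1 - s \<noteq> 0" using assms by (simp add: s_def)
  have c2: "c * c = (1 - s) * (1 + s)"
    using sin_cos_squared_add[of "\<tau> * l"] by (simp add: s_def c_def algebra_simps power2_eq_square)
  have d: "((\<lambda>x. cos (\<tau> * x) / (2 * x * (1 - sin (\<tau> * x)))) has_real_derivative
     ((- s * \<tau>) * (2 * l * (1 - s)) - c * (2 * (1 - s) + 2 * l * (- (c * \<tau>)))) / (2 * l * (1 - s))\<^sup>2) (at l)"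
    using assms unfolding s_def c_def
    by (auto intro!: derivative_eq_intros simp: power2_eq_square algebra_simps)
  have num: "(- s * \<tau>) * (2 * l * (1 - s)) - c * (2 * (1 - s) + 2 * l * (- (c * \<tau>)))
      = (1 - s) * (2 * (\<tau> * l - c))"
    using c2 by algebra
  have quot: "r * (2 * y) / (2 * l * r)\<^sup>2 = 1 / 2 * (inverse (l * l) * y * inverse r)"
    if "r \<noteq> 0" for r y
    using assms(1) that by (simp add: field_simps power2_eq_square)
  show ?thesis using d[unfolded num quot[OF s]] unfolding s_def c_def
  proof (rule has_field_derivative_transform_within_open)
    show "open {0 :: real<..}" "l \<in> {0<..}" using assms by auto
  qed (auto simp: mode_performance_def)
qed

theorem theorem4:
  fixes E :: "'n::finite set set" and w :: "'n set \<Rightarrow> real" and \<tau> :: real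
  assumes "connected_wgraph E w"
    and "\<tau> \<ge> 0"
    and "\<tau> * lambda_max (laplacian E w) < pi / 2"
    and "{i, j} \<in> E"
  shows "((\<lambda>\<delta>. rho_ss (laplacian E (w({i, j} := w {i, j} + \<delta>))) \<tau>) has_real_derivative
           (1/2) * (Evec i j \<bullet> ((pinv (laplacian E w ** laplacian E w)
              ** (\<tau> *\<^sub>R laplacian E w - mat_cos (\<tau> *\<^sub>R laplacian E w))
              ** pinv (Mn - mat_sin (\<tau> *\<^sub>R laplacian E w))) *v Evec i j))) (at 0)"
proof -
  let ?L = "laplacian E w" and ?a = "Evec i j"
  note conn = assms(1) and sym = transpose_laplacian[of E w]
  obtain B lam where eb: "eigenbasis ?L B lam" using symmetric_eigenbasis_exists[OF sym] .
  note B = eigenbasis_onb[OF eb]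
  have ij: "i \<noteq> j"
    using connected_wgraph_edgeE[OF conn assms(4)] by (metis doubleton_eq_iff)
  have upd: "laplacian E (w({i, j} := w {i, j} + \<delta>)) = ?L + \<delta> *\<^sub>R outer ?a ?a" for \<delta>
    by (simp only: laplacian_update[OF assms(4)] outer_Edge_vec[OF ij])
  have lam_max: "lam v \<le> lambda_max ?L" if "v \<in> B" for v
    unfolding lambda_max_def eigenvalues_eigenbasis[OF eb sym]
    using that onb_finite[OF B] by simp
  have lam_tau: "\<tau> * lam v < pi / 2" if "v \<in> B" for v
    using mult_left_mono[OF lam_max[OF that] assms(2)] assms(3) by linarith
  have nonneg: "0 \<le> lam v" if "v \<in> B" for v
    using laplacian_eigenvalue_nonneg[OF conn onb_norm[OF B that] eigenbasis_eigen[OF eb that]] .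
  \<comment> \<open>Excludes the eigenvalue 0, where \<open>mode_performance\<close> is not
    differentiable, from the modes that need a derivative.\<close>
  have ortho: "?a \<bullet> v = 0" if "v \<in> B" "lam v = 0" for v
    using laplacian_kernel[OF conn, of v i j] eigenbasis_eigen[OF eb that(1)] that(2)
    by (simp add: Evec_inner)

  define \<chi>0 where "\<chi>0 v = (if lam v = 0 then 0 else 1 :: real)" for v
  \<comment> \<open>The eigenvalue of half the matrix in the formula. On the consensus mode it is 0
    through \<open>inverse 0 = 0\<close>; elsewhere \<open>\<chi>0 v = 1\<close> and it is the
    derivative of the mode.\<close>
  define D where "D v = 1 / 2 * (inverse (lam v * lam v) * (\<tau> * lam v - cos (\<tau> * lam v))
      * inverse (\<chi>0 v - sin (\<tau> * lam v)))" for v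
  have der: "(mode_performance \<tau> has_real_derivative D v) (at (lam v))" if "v \<in> B" "?a \<bullet> v \<noteq> 0" for v
  proof -
    have "lam v \<noteq> 0" using ortho that by blast
    hence pos: "lam v > 0" using nonneg[OF that(1)] by simp
    have "sin (\<tau> * lam v) < 1"
      using sin_less_one[of "\<tau> * lam v"] pos assms(2) lam_tau[OF that(1)] by simp
    from mode_performance_has_derivative[OF pos this] pos show ?thesis by (simp add: D_def \<chi>0_def)
  qed
  have rhs: "(1/2) * (?a \<bullet> ((pinv (?L ** ?L) ** (\<tau> *\<^sub>R ?L - mat_cos (\<tau> *\<^sub>R ?L))
              ** pinv (Mn - mat_sin (\<tau> *\<^sub>R ?L))) *v ?a)) = (\<Sum>v\<in>B. D v * (?a \<bullet> v)\<^sup>2)"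
  proof -
    have L: "?L = spectral_mat B lam" by (rule eigenbasis_spectral_mat[OF eb])
    have "pinv (?L ** ?L) ** (\<tau> *\<^sub>R ?L - mat_cos (\<tau> *\<^sub>R ?L)) ** pinv (Mn - mat_sin (\<tau> *\<^sub>R ?L))
       = spectral_mat B (\<lambda>v. inverse (lam v * lam v) * (\<tau> *\<^sub>R lam v - cos (\<tau> *\<^sub>R lam v))
            * inverse (\<chi>0 v - sin (\<tau> *\<^sub>R lam v)))"
      unfolding Mn_spectral_mat[OF conn eb] \<chi>0_def[symmetric] L
      by (simp only: spectral_mat_mult[OF B] spectral_mat_scaleR spectral_mat_diff pinv_spectral_mat[OF B]
          mat_cos_spectral_mat[OF B] mat_sin_spectral_mat[OF B])
    thus ?thesis by (simp add: spectral_mat_quadratic_form D_def sum_distrib_left mult.assoc)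
  qed

  have wpos: "w {i, j} > 0" using conn assms(4) by (simp add: connected_wgraph_def)
  define N where "N = ?a \<bullet> ?a"
  define gap where "gap = pi / 2 - \<tau> * lambda_max ?L"
  \<comment> \<open>The first bound keeps the perturbed weight positive. The second keeps the
    perturbed spectrum in the stable range, since eigenvalues move by at most
    \<open>\<bar>\<delta>\<bar> * N\<close>; the added 1 covers
    \<open>\<tau> * N = 0\<close>.\<close>
  define d0 where "d0 = min (w {i, j}) (gap / (\<tau> * N + 1))"
  have N: "0 \<le> N" by (simp add: N_def)
  have tN: "\<tau> * N + 1 > 0" using N assms(2) by (simp add: add_nonneg_pos)
  have d0: "d0 > 0" using wpos assms(3) tN by (simp add: d0_def gap_def)
  have "\<exists>U mu. eigenbasis (?L + \<delta> *\<^sub>R outer ?a ?a) U mu \<and>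
      rho_ss (laplacian E (w({i, j} := w {i, j} + \<delta>))) \<tau> = (\<Sum>u\<in>U. mode_performance \<tau> (mu u))"
    if \<delta>: "\<bar>\<delta>\<bar> < d0" for \<delta>
  proof -
    let ?w = "w({i, j} := w {i, j} + \<delta>)"
    obtain U mu where U: "eigenbasis (laplacian E ?w) U mu"
      using symmetric_eigenbasis_exists[OF transpose_laplacian] .
    have "w {i, j} + \<delta> > 0" using \<delta> by (auto simp: d0_def)
    hence conn': "connected_wgraph E ?w" using conn by (simp add: connected_wgraph_def)
    have "\<tau> * mu u < pi / 2" if u: "u \<in> U" for u
    proof -
      have un: "norm u = 1" using onb_norm[OF eigenbasis_onb[OF U] u] .
      have ue: "(?L + \<delta> *\<^sub>R outer ?a ?a) *v u = mu u *\<^sub>R u"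
        using eigenbasis_eigen[OF U u] unfolding upd .
      obtain v where v: "v \<in> B" "\<bar>mu u - lam v\<bar> \<le> \<bar>\<delta>\<bar> * N"
        using rank_one_update_eigenvalue_near[OF eb sym un ue] unfolding N_def by blast
      have "mu u \<le> lambda_max ?L + \<bar>\<delta>\<bar> * N" using v(2) lam_max[OF v(1)] by linarith
      hence "\<tau> * mu u \<le> \<tau> * (lambda_max ?L + \<bar>\<delta>\<bar> * N)" using assms(2) by (rule mult_left_mono)
      moreover have "\<bar>\<delta>\<bar> * (\<tau> * N + 1) < gap"
        using \<delta> tN by (simp add: d0_def pos_less_divide_eq)
      hence "\<tau> * (\<bar>\<delta>\<bar> * N) + \<bar>\<delta>\<bar> < pi / 2 - \<tau> * lambda_max ?L" by (simp add: gap_def algebra_simps)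
      ultimately show ?thesis using abs_ge_zero[of \<delta>] unfolding distrib_left by linarith
    qed
    hence "rho_ss (laplacian E ?w) \<tau> = (\<Sum>u\<in>U. mode_performance \<tau> (mu u))"
      by (rule rho_ss_eigenbasis[OF conn' U assms(2)])
    thus ?thesis using U unfolding upd by blast
  qed
  from has_derivative_spectral_sum_rank_one[OF eb sym der d0 this] show ?thesis unfolding rhs .
qed

end
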